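(* Let $n\ge3$, and let $g,p$ be integers such that either $g>0$ and $p>0$, or $g=0$ and $p>2$. Let $\rho_U: B_{n-1}(\Sigma_{g,p})\to\mathrm{Aut}(U_{n-1,g,p})$ be the representation given by conjugation and let $q:\mathrm{Aut}(U_{n-1,g,p})\to\mathrm{Out}(U_{n-1,g,p})$ be the canonical projection. Then the representation $q\circ\rho_U: B_{n-1}(\Sigma_{g,p})\to\mathrm{Out}(U_{n-1,g,p})$ is faithful (i.e. injective).
   Context: Conventions: $a^b=b^{-1}ab$ and $[a,b]=a^{-1}b^{-1}ab$. Automorphisms act on the right: a product $\alpha\beta$ of automorphisms means first $\alpha$, then $\beta$. $\Sigma_{g,p}$ is the compact connected orientable surface of genus $g$ with $p$ boundary components. $B_n(\Sigma)$ is the $n$-strand braid group of the surface $\Sigma$: isotopy classes (rel endpoints) of $n$-tuples of disjoint paths in $\Sigma\times[0,1]$, monotone in the $[0,1]$ coordinate, from $\mathcal P\times\{0\}$ to $\mathcal P\times\{1\}$, where $\mathcal P$ is a fixed set of $n$ interior points. For $p>0$ and $n\ge 2$, $B_n(\Sigma_{g,p})$ has the following presentation (known). Generators $\sigma_1,\dots,\sigma_{n-1},x_1,\dots,x_{2g},z_1,\dots,z_{p-1}$ (the $\sigma_i$ are the standard braid generators of an embedded disk; the $x_r$, $z_j$ are standard generators of $\pi_1(\Sigma_{g,p})$, the $z_j$ being loops around holes, performed by the first strand). Relations: $\sigma_i\sigma_{i+1}\sigma_i=\sigma_{i+1}\sigma_i\sigma_{i+1}$; $\sigma_i\sigma_j=\sigma_j\sigma_i$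 for $|i-j|>1$; $x_r\sigma_i=\sigma_ix_r$ and $z_j\sigma_i=\sigma_iz_j$ for $i\ne1$; $(\sigma_1^{-1}x_r\sigma_1^{-1})x_r=x_r(\sigma_1^{-1}x_r\sigma_1^{-1})$; $(\sigma_1^{-1}x_s\sigma_1)x_r=x_r(\sigma_1^{-1}x_s\sigma_1)$ for $s<r$, $(s,r)\neq(2m-1,2m)$; $(\sigma_1^{-1}x_{2m-1}\sigma_1^{-1})x_{2m}=x_{2m}(\sigma_1^{-1}x_{2m-1}\sigma_1)$ for $1\le m\le g$; $(\sigma_1^{-1}z_j\sigma_1)x_r=x_r(\sigma_1^{-1}z_j\sigma_1)$; $(\sigma_1^{-1}z_j\sigma_1)z_l=z_l(\sigma_1^{-1}z_j\sigma_1)$ for $j<l$; $(\sigma_1^{-1}z_j\sigma_1^{-1})z_j=z_j(\sigma_1^{-1}z_j\sigma_1^{-1})$. The subgroup of $B_n(\Sigma_{g,p})$ generated by $\sigma_1,\dots,\sigma_{n-2},x_1,\dots,x_{2g},z_1,\dots,z_{p-1}$ is isomorphic to, and identified with, $B_{n-1}(\Sigma_{g,p})$. In $B_n(\Sigma_{g,p})$ put $\tau_k=\sigma_{n-1}\cdots\sigma_{k+1}\sigma_k^2\sigma_{k+1}^{-1}\cdots\sigma_{n-1}^{-1}$ ($1\le k\le n-2$), $\tau_{n-1}=\sigma_{n-1}^2$, $w_r=\sigma_{n-1}\cdots\sigma_1x_r\sigma_1^{-1}\cdots\sigma_{n-1}^{-1}$ ($1\le r\le 2g$), $\xi_j=\sigma_{n-1}\cdots\sigma_1z_j\sigma_1^{-1}\cdots\sigma_{n-1}^{-1}$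 ($1\le j\le p-1$). $U_{n-1,g,p}$ is the subgroup generated by all $\tau_k,w_r,\xi_j$; it is free on these $n+p+2g-2$ generators and is normalized by $B_{n-1}(\Sigma_{g,p})$. The representation $\rho_U$ is the conjugation action $u\mapsto u^\beta=\beta^{-1}u\beta$. Explicitly: $\sigma_i$ ($1\le i\le n-2$): $\tau_i\mapsto \tau_{i+1}^{\tau_i^{-1}}$, $\tau_{i+1}\mapsto \tau_i$, all other basis elements fixed. $x_r$ ($1\le r\le 2g$): $\tau_1\mapsto\tau_1^{w_r^{-1}\tau_1}$; $\tau_i\mapsto\tau_i$ for $i\ge2$; $w_s\mapsto w_s^{[w_r^{-1},\tau_1]}$ for $s<r$, $(s,r)\ne(2m-1,2m)$; $w_{r-1}\mapsto[\tau_1,w_r^{-1}]w_{r-1}\tau_1$ if $r=2m$; $w_r\mapsto w_r^{\tau_1}$; $w_s\mapsto w_s$ for $r<s$, $(r,s)\ne(2m-1,2m)$; $w_{r+1}\mapsto\tau_1^{-1}w_{r+1}$ if $r=2m-1$; $\xi_j\mapsto\xi_j^{[w_r^{-1},\tau_1]}$. $z_j$ ($1\le j\le p-1$): $\tau_1\mapsto\tau_1^{\xi_j^{-1}\tau_1}$; $\tau_i\mapsto\tau_i$ for $i\ge2$; $w_r\mapsto w_r$; $\xi_l\mapsto\xi_l^{[\xi_j^{-1},\tau_1]}$ for $l<j$; $\xi_j\mapsto\xi_j^{\tau_1}$; $\xi_l\mapsto\xi_l$ for $l>j$. *)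

theory Defs
  imports "HOL-Algebra.Generated_Groups" "HOL-Algebra.Bij"
begin

section \<open>Groups given by generators and relations\<close>

text \<open>A letter \<open>(a, True)\<close> stands for the generator \<open>a\<close>, and \<open>(a, False)\<close> for its inverse.\<close>

type_synonym 'a word = "('a \<times> bool) list"

definition winv :: "'a word \<Rightarrow> 'a word"
  where "winv w = map (\<lambda>(a, e). (a, \<not> e)) (rev w)"

definition words :: "'a set \<Rightarrow> 'a word set"
  where "words A = lists (A \<times> UNIV)"

inductive pres_eq :: "'a set \<Rightarrow> ('a word \<times> 'a word) set \<Rightarrow> 'a word \<Rightarrow> 'a word \<Rightarrow> bool"
  for A :: "'a set" and R :: "('a word \<times> 'a word) set"
where
  refl: "w \<in> words A \<Longrightarrow> pres_eq A R w w"
| sym: "pres_eq A R u v \<Longrightarrow> pres_eq A R v u"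
| trans: "pres_eq A R u v \<Longrightarrow> pres_eq A R v w \<Longrightarrow> pres_eq A R u w"
| append: "pres_eq A R u v \<Longrightarrow> pres_eq A R u' v' \<Longrightarrow> pres_eq A R (u @ u') (v @ v')"
| cancel: "a \<in> A \<Longrightarrow> pres_eq A R [(a, e), (a, \<not> e)] []"
| rel: "(u, v) \<in> R \<Longrightarrow> u \<in> words A \<Longrightarrow> v \<in> words A \<Longrightarrow> pres_eq A R u v"

definition word_class :: "'a set \<Rightarrow> ('a word \<times> 'a word) set \<Rightarrow> 'a word \<Rightarrow> 'a word set"
  where "word_class A R w = {v. pres_eq A R w v}"

definition presented_group :: "'a set \<Rightarrow> ('a word \<times> 'a word) set \<Rightarrow> 'a word set monoid"
  where "presented_group A R =
    \<lparr>carrier = word_class A R ` words A,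
     mult = \<lambda>X Y. \<Union>u\<in>X. \<Union>v\<in>Y. word_class A R (u @ v),
     one = word_class A R []\<rparr>"

lemma words_simps [simp]:
  "[] \<in> words A"
  "x # w \<in> words A \<longleftrightarrow> fst x \<in> A \<and> w \<in> words A"
  "u @ v \<in> words A \<longleftrightarrow> u \<in> words A \<and> v \<in> words A"
  by (auto simp: words_def mem_Times_iff)

lemma winv_simps [simp]:
  "winv [] = []" "winv (x # w) = winv w @ [(fst x, \<not> snd x)]" "winv (u @ v) = winv v @ winv u"
  by (auto simp: winv_def split: prod.splits)

lemma winv_words [simp]: "winv w \<in> words A \<longleftrightarrow> w \<in> words A"
  by (induction w) auto

lemma pres_eq_words: "pres_eq A R u v \<Longrightarrow> u \<in> words A \<and> v \<in> words A"
  by (induction rule: pres_eq.induct) auto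

lemma pres_eq_winv: "w \<in> words A \<Longrightarrow> pres_eq A R (winv w @ w) []"
proof (induction w)
  case Nil
  then show ?case by (simp add: pres_eq.refl)
next
  case (Cons x w)
  then have x: "fst x \<in> A" and w: "w \<in> words A" by auto
  have "pres_eq A R [(fst x, \<not> snd x), x] []"
    using pres_eq.cancel[OF x, of R "\<not> snd x"] by simp
  then have "pres_eq A R (winv w @ [(fst x, \<not> snd x), x] @ w) (winv w @ [] @ w)"
    using w by (intro pres_eq.append) (auto intro: pres_eq.refl)
  then show ?case
    using pres_eq.trans[OF _ Cons.IH[OF w]] by simp
qed

lemma word_class_eq_iff:
  "u \<in> words A \<Longrightarrow> word_class A R u = word_class A R v \<longleftrightarrow> pres_eq A R u v"
  unfolding word_class_def set_eq_iff mem_Collect_eq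
  by (metis pres_eq.refl pres_eq.sym pres_eq.trans)

lemma mem_word_class_self: "w \<in> words A \<Longrightarrow> w \<in> word_class A R w"
  by (auto simp: word_class_def intro: pres_eq.refl)

lemma word_class_mult:
  assumes "u \<in> words A" "v \<in> words A"
  shows "word_class A R u \<otimes>\<^bsub>presented_group A R\<^esub> word_class A R v = word_class A R (u @ v)"
proof -
  have "word_class A R (u' @ v') = word_class A R (u @ v)"
    if "u' \<in> word_class A R u" "v' \<in> word_class A R v" for u' v'
  proof -
    have "pres_eq A R (u @ v) (u' @ v')"
      using that unfolding word_class_def mem_Collect_eq by (rule pres_eq.append)
    then show ?thesis
      using assms by (simp add: word_class_eq_iff[symmetric])
  qed
  moreover have "u \<in> word_class A R u" "v \<in> word_class A R v"
    using assms by (auto intro: mem_word_class_self)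
  ultimately have "(\<Union>u'\<in>word_class A R u. \<Union>v'\<in>word_class A R v. word_class A R (u' @ v'))
      = word_class A R (u @ v)"
    by blast
  then show ?thesis
    by (simp add: presented_group_def)
qed

lemma carrier_presented_group: "carrier (presented_group A R) = word_class A R ` words A"
  by (simp add: presented_group_def)

lemma one_presented_group: "\<one>\<^bsub>presented_group A R\<^esub> = word_class A R []"
  by (simp add: presented_group_def)

lemma group_presented_group: "group (presented_group A R)"
proof (rule groupI)
  fix X assume "X \<in> carrier (presented_group A R)"
  then obtain w where w: "w \<in> words A" "X = word_class A R w"
    by (auto simp: carrier_presented_group)
  have "word_class A R (winv w @ w) = word_class A R []"
    using w(1) pres_eq_winv[OF w(1), of R] by (simp add: word_class_eq_iff)
  then have "word_class A R (winv w) \<otimes>\<^bsub>presented_group A R\<^esub> X = \<one>\<^bsub>presented_group A R\<^esub>"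
    using w by (simp add: one_presented_group word_class_mult)
  then show "\<exists>Y\<in>carrier (presented_group A R). Y \<otimes>\<^bsub>presented_group A R\<^esub> X = \<one>\<^bsub>presented_group A R\<^esub>"
    using w by (force simp: carrier_presented_group)
qed (auto simp: carrier_presented_group one_presented_group word_class_mult)

lemma inv_word_class:
  assumes "w \<in> words A"
  shows "inv\<^bsub>presented_group A R\<^esub> (word_class A R w) = word_class A R (winv w)"
proof (rule group.inv_equality[OF group_presented_group])
  show "word_class A R (winv w) \<otimes>\<^bsub>presented_group A R\<^esub> word_class A R w = \<one>\<^bsub>presented_group A R\<^esub>"
    using assms pres_eq_winv[OF assms, of R]
    by (simp add: word_class_mult one_presented_group word_class_eq_iff)
qed (use assms in \<open>auto simp: carrier_presented_group\<close>)


section \<open>Braid groups of surfaces with boundary\<close>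

text \<open>The group \<open>B\<^sub>n(\<Sigma>\<^sub>g\<^sub>,\<^sub>p)\<close>, for \<open>n \<ge> 2\<close> and \<open>p > 0\<close>, is defined by its
  standard presentation: \<open>\<sigma>\<^sub>1, \<dots>, \<sigma>\<^sub>n\<^sub>-\<^sub>1\<close> are the braid generators of an embedded disk, and
  \<open>x\<^sub>1, \<dots>, x\<^sub>2\<^sub>g\<close> and \<open>z\<^sub>1, \<dots>, z\<^sub>p\<^sub>-\<^sub>1\<close> are standard generators of the fundamental group of the
  surface, performed by the first strand. All indices start at 1.\<close>

datatype braid_gen = Sigma_gen nat | X_gen nat | Z_gen nat

abbreviation sigma :: "nat \<Rightarrow> braid_gen word" where "sigma i \<equiv> [(Sigma_gen i, True)]"
abbreviation sigma_inv :: "nat \<Rightarrow> braid_gen word" where "sigma_inv i \<equiv> [(Sigma_gen i, False)]"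
abbreviation xgen :: "nat \<Rightarrow> braid_gen word" where "xgen r \<equiv> [(X_gen r, True)]"
abbreviation zgen :: "nat \<Rightarrow> braid_gen word" where "zgen j \<equiv> [(Z_gen j, True)]"

definition braid_gens :: "nat \<Rightarrow> nat \<Rightarrow> nat \<Rightarrow> braid_gen set"
  where "braid_gens n g p = Sigma_gen ` {1..n - 1} \<union> X_gen ` {1..2 * g} \<union> Z_gen ` {1..p - 1}"

definition handle_pair :: "nat \<Rightarrow> nat \<Rightarrow> bool"
  where "handle_pair s r \<longleftrightarrow> (\<exists>m\<ge>1. s = 2 * m - 1 \<and> r = 2 * m)"

definition braid_rels :: "nat \<Rightarrow> nat \<Rightarrow> nat \<Rightarrow> (braid_gen word \<times> braid_gen word) set"
  where "braid_rels n g p =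
    {(sigma i @ sigma (i + 1) @ sigma i, sigma (i + 1) @ sigma i @ sigma (i + 1)) | i.
       i \<in> {1..n - 1} \<and> i + 1 \<in> {1..n - 1}} \<union>
    {(sigma i @ sigma j, sigma j @ sigma i) | i j.
       i \<in> {1..n - 1} \<and> j \<in> {1..n - 1} \<and> (i + 1 < j \<or> j + 1 < i)} \<union>
    {(xgen r @ sigma i, sigma i @ xgen r) | r i.
       r \<in> {1..2 * g} \<and> i \<in> {1..n - 1} \<and> i \<noteq> 1} \<union>
    {(zgen j @ sigma i, sigma i @ zgen j) | j i.
       j \<in> {1..p - 1} \<and> i \<in> {1..n - 1} \<and> i \<noteq> 1} \<union>
    {((sigma_inv 1 @ xgen r @ sigma_inv 1) @ xgen r,
      xgen r @ (sigma_inv 1 @ xgen r @ sigma_inv 1)) | r.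
       r \<in> {1..2 * g}} \<union>
    {((sigma_inv 1 @ xgen s @ sigma 1) @ xgen r,
      xgen r @ (sigma_inv 1 @ xgen s @ sigma 1)) | s r.
       s \<in> {1..2 * g} \<and> r \<in> {1..2 * g} \<and> s < r \<and> \<not> handle_pair s r} \<union>
    {((sigma_inv 1 @ xgen (2 * m - 1) @ sigma_inv 1) @ xgen (2 * m),
      xgen (2 * m) @ (sigma_inv 1 @ xgen (2 * m - 1) @ sigma 1)) | m.
       m \<in> {1..g}} \<union>
    {((sigma_inv 1 @ zgen j @ sigma 1) @ xgen r,
      xgen r @ (sigma_inv 1 @ zgen j @ sigma 1)) | j r.
       j \<in> {1..p - 1} \<and> r \<in> {1..2 * g}} \<union>
    {((sigma_inv 1 @ zgen j @ sigma 1) @ zgen l,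
      zgen l @ (sigma_inv 1 @ zgen j @ sigma 1)) | j l.
       j \<in> {1..p - 1} \<and> l \<in> {1..p - 1} \<and> j < l} \<union>
    {((sigma_inv 1 @ zgen j @ sigma_inv 1) @ zgen j,
      zgen j @ (sigma_inv 1 @ zgen j @ sigma_inv 1)) | j.
       j \<in> {1..p - 1}}"

definition braid_class :: "nat \<Rightarrow> nat \<Rightarrow> nat \<Rightarrow> braid_gen word \<Rightarrow> braid_gen word set"
  where "braid_class n g p = word_class (braid_gens n g p) (braid_rels n g p)"

definition surface_braid_group :: "nat \<Rightarrow> nat \<Rightarrow> nat \<Rightarrow> braid_gen word set monoid"
  where "surface_braid_group n g p = presented_group (braid_gens n g p) (braid_rels n g p)"

lemma group_surface_braid_group: "group (surface_braid_group n g p)"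
  by (simp add: surface_braid_group_def group_presented_group)

text \<open>The homomorphism \<open>B\<^sub>n\<^sub>-\<^sub>1 \<rightarrow> B\<^sub>n\<close> that sends every generator to the generator
  of the same name; through it \<open>B\<^sub>n\<^sub>-\<^sub>1\<close> is identified with a subgroup of \<open>B\<^sub>n\<close>.
  All the classes in the union coincide (see \<open>add_strand_braid_class\<close>).\<close>

definition add_strand :: "nat \<Rightarrow> nat \<Rightarrow> nat \<Rightarrow> braid_gen word set \<Rightarrow> braid_gen word set"
  where "add_strand n g p X = (\<Union>w\<in>X. braid_class n g p w)"

lemma braid_gens_mono: "braid_gens (n - 1) g p \<subseteq> braid_gens n g p"
  by (auto simp: braid_gens_def)

lemma words_braid_gens_mono: "w \<in> words (braid_gens (n - 1) g p) \<Longrightarrow> w \<in> words (braid_gens n g p)"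
  using lists_mono[OF Sigma_mono[OF braid_gens_mono[of n g p] subset_refl]]
  unfolding words_def by blast

lemma braid_rels_mono: "braid_rels (n - 1) g p \<subseteq> braid_rels n g p"
proof -
  have "i \<in> {1..n - 1 - 1} \<Longrightarrow> i \<in> {1..n - 1}" for i :: nat
    by auto
  then show ?thesis
    unfolding braid_rels_def by (intro Un_mono) blast+
qed

lemma pres_eq_braid_mono:
  assumes "pres_eq (braid_gens (n - 1) g p) (braid_rels (n - 1) g p) u v"
  shows "pres_eq (braid_gens n g p) (braid_rels n g p) u v"
  using assms
proof (induction rule: pres_eq.induct)
  case (cancel a e)
  then show ?case using braid_gens_mono by (blast intro: pres_eq.cancel)
next
  case (rel u v)
  then show ?case
    using braid_rels_mono words_braid_gens_mono by (blast intro: pres_eq.rel)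
qed (use words_braid_gens_mono in \<open>blast intro: pres_eq.refl pres_eq.sym pres_eq.trans pres_eq.append\<close>)+

lemma add_strand_braid_class:
  assumes "w \<in> words (braid_gens (n - 1) g p)"
  shows "add_strand n g p (braid_class (n - 1) g p w) = braid_class n g p w"
proof -
  have "braid_class n g p v = braid_class n g p w" if "v \<in> braid_class (n - 1) g p w" for v
  proof -
    have "pres_eq (braid_gens n g p) (braid_rels n g p) w v"
      using that pres_eq_braid_mono by (auto simp: braid_class_def word_class_def)
    then show ?thesis
      using words_braid_gens_mono[OF assms] by (simp add: braid_class_def word_class_eq_iff[symmetric])
  qed
  moreover have "w \<in> braid_class (n - 1) g p w"
    using assms by (simp add: braid_class_def mem_word_class_self)
  ultimately show ?thesis
    unfolding add_strand_def by blast
qed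

lemma carrier_surface_braid_group:
  "carrier (surface_braid_group n g p) = braid_class n g p ` words (braid_gens n g p)"
  by (simp add: surface_braid_group_def braid_class_def carrier_presented_group)

lemma braid_class_mult:
  "u \<in> words (braid_gens n g p) \<Longrightarrow> v \<in> words (braid_gens n g p) \<Longrightarrow>
    braid_class n g p u \<otimes>\<^bsub>surface_braid_group n g p\<^esub> braid_class n g p v = braid_class n g p (u @ v)"
  by (simp add: surface_braid_group_def braid_class_def word_class_mult)

lemma add_strand_hom:
  "add_strand n g p \<in> hom (surface_braid_group (n - 1) g p) (surface_braid_group n g p)"
proof (rule homI)
  fix X assume "X \<in> carrier (surface_braid_group (n - 1) g p)"
  then obtain u where u: "u \<in> words (braid_gens (n - 1) g p)" "X = braid_class (n - 1) g p u"
    unfolding carrier_surface_braid_group by blast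
  show "add_strand n g p X \<in> carrier (surface_braid_group n g p)"
    unfolding u(2) add_strand_braid_class[OF u(1)] carrier_surface_braid_group
    using words_braid_gens_mono[OF u(1)] by blast
  fix Y assume "Y \<in> carrier (surface_braid_group (n - 1) g p)"
  then obtain v where v: "v \<in> words (braid_gens (n - 1) g p)" "Y = braid_class (n - 1) g p v"
    unfolding carrier_surface_braid_group by blast
  have "u @ v \<in> words (braid_gens (n - 1) g p)"
    using u v by simp
  then show "add_strand n g p (X \<otimes>\<^bsub>surface_braid_group (n - 1) g p\<^esub> Y) =
      add_strand n g p X \<otimes>\<^bsub>surface_braid_group n g p\<^esub> add_strand n g p Y"
    unfolding u(2) v(2) braid_class_mult[OF u(1) v(1)]
    by (simp only: add_strand_braid_class[OF u(1)] add_strand_braid_class[OF v(1)]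
        add_strand_braid_class braid_class_mult words_braid_gens_mono[OF u(1)]
        words_braid_gens_mono[OF v(1)])
qed


section \<open>The free subgroup\<close>

text \<open>\<open>sigma_down n k\<close> is the word \<open>\<sigma>\<^sub>n\<^sub>-\<^sub>1 \<dots> \<sigma>\<^sub>k\<close>, which is empty for \<open>k = n\<close>;
  hence \<open>tau_word n (n - 1)\<close> is the square of \<open>\<sigma>\<^sub>n\<^sub>-\<^sub>1\<close>.\<close>

definition sigma_down :: "nat \<Rightarrow> nat \<Rightarrow> braid_gen word"
  where "sigma_down n k = concat (map sigma (rev [k..<n]))"

definition tau_word :: "nat \<Rightarrow> nat \<Rightarrow> braid_gen word"
  where "tau_word n k = sigma_down n (k + 1) @ sigma k @ sigma k @ winv (sigma_down n (k + 1))"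

definition w_word :: "nat \<Rightarrow> nat \<Rightarrow> braid_gen word"
  where "w_word n r = sigma_down n 1 @ xgen r @ winv (sigma_down n 1)"

definition xi_word :: "nat \<Rightarrow> nat \<Rightarrow> braid_gen word"
  where "xi_word n j = sigma_down n 1 @ zgen j @ winv (sigma_down n 1)"

definition U_gens :: "nat \<Rightarrow> nat \<Rightarrow> nat \<Rightarrow> braid_gen word set set"
  where "U_gens n g p = braid_class n g p `
    (tau_word n ` {1..n - 1} \<union> w_word n ` {1..2 * g} \<union> xi_word n ` {1..p - 1})"

text \<open>The first argument is the number of strands of the ambient braid group: \<open>U_group n g p\<close>
  is \<open>U\<^sub>n\<^sub>-\<^sub>1\<^sub>,\<^sub>g\<^sub>,\<^sub>p \<le> B\<^sub>n(\<Sigma>\<^sub>g\<^sub>,\<^sub>p)\<close>.\<close>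

definition U_group :: "nat \<Rightarrow> nat \<Rightarrow> nat \<Rightarrow> braid_gen word set monoid"
  where "U_group n g p = subgroup_generated (surface_braid_group n g p) (U_gens n g p)"

lemma group_U_group: "group (U_group n g p)"
  unfolding U_group_def by (rule group.group_subgroup_generated[OF group_surface_braid_group])


section \<open>Automorphisms acting on the right, and outer automorphisms\<close>

text \<open>Automorphisms act on the right, so \<open>\<alpha>\<close> times \<open>\<beta>\<close> is first \<open>\<alpha>\<close>, then \<open>\<beta>\<close>. This is opposite
  to the multiplication of \<^const>\<open>AutoGroup\<close>.\<close>

definition right_Aut :: "('a, 'b) monoid_scheme \<Rightarrow> ('a \<Rightarrow> 'a) monoid"
  where "right_Aut G = (AutoGroup G)\<lparr>mult := \<lambda>\<alpha> \<beta>. \<beta> \<otimes>\<^bsub>AutoGroup G\<^esub> \<alpha>\<rparr>"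

definition conj_on :: "('a, 'b) monoid_scheme \<Rightarrow> 'a set \<Rightarrow> 'a \<Rightarrow> 'a \<Rightarrow> 'a"
  where "conj_on G S b = (\<lambda>u\<in>S. inv\<^bsub>G\<^esub> b \<otimes>\<^bsub>G\<^esub> u \<otimes>\<^bsub>G\<^esub> b)"

definition Inn :: "('a, 'b) monoid_scheme \<Rightarrow> ('a \<Rightarrow> 'a) set"
  where "Inn G = conj_on G (carrier G) ` carrier G"

definition Out :: "('a, 'b) monoid_scheme \<Rightarrow> ('a \<Rightarrow> 'a) set monoid"
  where "Out G = right_Aut G Mod Inn G"

definition Out_proj :: "('a, 'b) monoid_scheme \<Rightarrow> ('a \<Rightarrow> 'a) \<Rightarrow> ('a \<Rightarrow> 'a) set"
  where "Out_proj G \<alpha> = Inn G #>\<^bsub>right_Aut G\<^esub> \<alpha>"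

lemma carrier_right_Aut: "carrier (right_Aut G) = auto G"
  by (simp add: right_Aut_def AutoGroup_def)

lemma one_right_Aut: "\<one>\<^bsub>right_Aut G\<^esub> = (\<lambda>x\<in>carrier G. x)"
  by (simp add: right_Aut_def AutoGroup_def BijGroup_def)

lemma mult_right_Aut:
  "\<alpha> \<in> auto G \<Longrightarrow> \<beta> \<in> auto G \<Longrightarrow> \<alpha> \<otimes>\<^bsub>right_Aut G\<^esub> \<beta> = compose (carrier G) \<beta> \<alpha>"
  by (simp add: right_Aut_def AutoGroup_def BijGroup_def auto_def)

lemma (in group) group_right_Aut: "group (right_Aut G)"
proof -
  interpret A: group "AutoGroup G" by (rule AutoGroup)
  show ?thesis
  proof (rule groupI)
    fix \<alpha> assume "\<alpha> \<in> carrier (right_Aut G)"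
    then show "\<exists>\<beta>\<in>carrier (right_Aut G). \<beta> \<otimes>\<^bsub>right_Aut G\<^esub> \<alpha> = \<one>\<^bsub>right_Aut G\<^esub>"
      by (auto simp: right_Aut_def intro!: bexI[of _ "inv\<^bsub>AutoGroup G\<^esub> \<alpha>"])
  qed (auto simp: right_Aut_def A.m_assoc)
qed

lemma (in group) inv_mult_cancel: "a \<in> carrier G \<Longrightarrow> u \<in> carrier G \<Longrightarrow> inv a \<otimes> (a \<otimes> u) = u"
  by (simp add: m_assoc[symmetric])

lemma (in group) mult_inv_cancel: "a \<in> carrier G \<Longrightarrow> u \<in> carrier G \<Longrightarrow> a \<otimes> (inv a \<otimes> u) = u"
  by (simp add: m_assoc[symmetric])

lemma (in group) conj_on_auto:
  assumes "a \<in> carrier G"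
  shows "conj_on G (carrier G) a \<in> auto G"
proof -
  have "bij_betw (conj_on G (carrier G) a) (carrier G) (carrier G)"
    by (rule bij_betwI[where g = "\<lambda>u. a \<otimes> u \<otimes> inv a"])
      (use assms in \<open>auto simp: conj_on_def m_assoc inv_mult_cancel mult_inv_cancel\<close>)
  moreover have "conj_on G (carrier G) a \<in> hom G G"
    using assms
    by (auto simp: conj_on_def hom_def m_assoc mult_inv_cancel)
  ultimately show ?thesis
    by (simp add: auto_def Bij_def conj_on_def)
qed

lemma (in group) conj_on_right_Aut:
  "a \<in> carrier G \<Longrightarrow> conj_on G (carrier G) a \<in> carrier (right_Aut G)"
  by (simp add: carrier_right_Aut conj_on_auto)

lemma (in group) conj_on_mult:
  assumes "a \<in> carrier G" "b \<in> carrier G"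
  shows "conj_on G (carrier G) a \<otimes>\<^bsub>right_Aut G\<^esub> conj_on G (carrier G) b =
    conj_on G (carrier G) (a \<otimes> b)"
  using assms
  by (simp add: mult_right_Aut conj_on_auto)
    (auto simp: compose_def conj_on_def m_assoc inv_mult_group intro!: restrict_ext)

lemma (in group) conj_on_one: "conj_on G (carrier G) \<one> = \<one>\<^bsub>right_Aut G\<^esub>"
  by (auto simp: one_right_Aut conj_on_def intro!: restrict_ext)

lemma (in group) conj_on_natural:
  assumes "\<alpha> \<in> auto G" "a \<in> carrier G"
  shows "conj_on G (carrier G) a \<otimes>\<^bsub>right_Aut G\<^esub> \<alpha> =
    \<alpha> \<otimes>\<^bsub>right_Aut G\<^esub> conj_on G (carrier G) (\<alpha> a)"
proof -
  have h: "\<alpha> \<in> hom G G"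
    using assms by (simp add: auto_def)
  then interpret \<alpha>: group_hom G G \<alpha>
    by unfold_locales
  show ?thesis
    using assms
    by (simp add: mult_right_Aut conj_on_auto)
      (auto simp: compose_def conj_on_def intro!: restrict_ext)
qed

lemma (in group) Inn_normal: "Inn G \<lhd> right_Aut G"
proof -
  interpret A: group "right_Aut G" by (rule group_right_Aut)
  have sub: "subgroup (Inn G) (right_Aut G)"
  proof (rule A.subgroupI)
    show "Inn G \<subseteq> carrier (right_Aut G)"
      by (auto simp: Inn_def carrier_right_Aut conj_on_auto)
    show "Inn G \<noteq> {}"
      by (auto simp: Inn_def)
    show "inv\<^bsub>right_Aut G\<^esub> \<alpha> \<in> Inn G" if \<alpha>: "\<alpha> \<in> Inn G" for \<alpha>
    proof -
      obtain a where a: "a \<in> carrier G" "\<alpha> = conj_on G (carrier G) a"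
        using \<alpha> by (auto simp: Inn_def)
      have "inv\<^bsub>right_Aut G\<^esub> \<alpha> = conj_on G (carrier G) (inv a)"
        using a by (intro A.inv_equality)
          (simp_all add: conj_on_mult conj_on_one carrier_right_Aut conj_on_auto)
      then show ?thesis
        using a by (simp add: Inn_def)
    qed
    show "\<alpha> \<otimes>\<^bsub>right_Aut G\<^esub> \<beta> \<in> Inn G" if "\<alpha> \<in> Inn G" "\<beta> \<in> Inn G" for \<alpha> \<beta>
      using that by (auto simp: Inn_def conj_on_mult)
  qed
  show ?thesis
    unfolding A.normal_inv_iff
  proof (intro conjI sub ballI)
    fix \<alpha> \<beta> assume \<alpha>: "\<alpha> \<in> carrier (right_Aut G)" and "\<beta> \<in> Inn G"
    then obtain a where a: "a \<in> carrier G" "\<beta> = conj_on G (carrier G) a"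
      by (auto simp: Inn_def)
    have "inv\<^bsub>right_Aut G\<^esub> \<alpha> \<in> auto G"
      using A.inv_closed[OF \<alpha>] by (simp add: carrier_right_Aut)
    then have mem: "(inv\<^bsub>right_Aut G\<^esub> \<alpha>) a \<in> carrier G"
      using a by (auto simp: auto_def hom_def)
    have "\<alpha> \<otimes>\<^bsub>right_Aut G\<^esub> \<beta> \<otimes>\<^bsub>right_Aut G\<^esub> inv\<^bsub>right_Aut G\<^esub> \<alpha> =
        \<alpha> \<otimes>\<^bsub>right_Aut G\<^esub> (\<beta> \<otimes>\<^bsub>right_Aut G\<^esub> inv\<^bsub>right_Aut G\<^esub> \<alpha>)"
      using \<alpha> a by (intro A.m_assoc) (simp_all add: carrier_right_Aut[symmetric] conj_on_right_Aut)
    also have "\<dots> = \<alpha> \<otimes>\<^bsub>right_Aut G\<^esub>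
        (inv\<^bsub>right_Aut G\<^esub> \<alpha> \<otimes>\<^bsub>right_Aut G\<^esub> conj_on G (carrier G) ((inv\<^bsub>right_Aut G\<^esub> \<alpha>) a))"
      using a \<open>inv\<^bsub>right_Aut G\<^esub> \<alpha> \<in> auto G\<close> by (simp add: conj_on_natural)
    also have "\<dots> = conj_on G (carrier G) ((inv\<^bsub>right_Aut G\<^esub> \<alpha>) a)"
      using \<alpha> mem by (simp add: A.m_assoc[symmetric] conj_on_right_Aut)
    finally show "\<alpha> \<otimes>\<^bsub>right_Aut G\<^esub> \<beta> \<otimes>\<^bsub>right_Aut G\<^esub> inv\<^bsub>right_Aut G\<^esub> \<alpha> \<in> Inn G"
      using mem by (simp add: Inn_def)
  qed
qed

lemma (in group) group_Out: "group (Out G)"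
  unfolding Out_def by (rule normal.factorgroup_is_group[OF Inn_normal])

lemma (in group) Out_proj_hom: "Out_proj G \<in> hom (right_Aut G) (Out G)"
  using normal.r_coset_hom_Mod[OF Inn_normal] by (simp add: Out_def Out_proj_def[abs_def])


section \<open>The representation by conjugation\<close>

definition rho_U :: "nat \<Rightarrow> nat \<Rightarrow> nat \<Rightarrow> braid_gen word set \<Rightarrow> braid_gen word set \<Rightarrow> braid_gen word set"
  where "rho_U n g p \<beta> =
    conj_on (surface_braid_group n g p) (carrier (U_group n g p)) (add_strand n g p \<beta>)"

end

theory Submission
  imports Defs
begin

text \<open>The conjugation formulas define an action of the braid group on \<open>m\<close> strands on tuples
  \<open>(\<tau>\<^sub>i, w\<^sub>r, \<xi>\<^sub>j)\<close> in an arbitrary group. If such a braid acts on \<open>U\<^sub>m\<close> as an inner automorphism, it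
  fixes the conjugacy class of \<open>\<tau>\<^sub>m\<close>, so it is a product \<open>u \<gamma>\<close> with \<open>u \<in> U\<^sub>m\<^sub>-\<^sub>1\<close> and \<open>\<gamma>\<close> a braid on
  \<open>m - 1\<close> strands. Modulo \<open>\<tau>\<^sub>m\<close> the factor \<open>u\<close> acts trivially; hence \<open>\<gamma>\<close> again acts as an inner
  automorphism, and \<open>\<gamma> = 1\<close> by induction. The conjugating element is then central modulo \<open>\<tau>\<^sub>m\<close>, so it
  vanishes in the free group on the remaining generators, which has rank at least two by the
  assumption on \<open>g\<close> and \<open>p\<close>. On the other hand \<open>u\<close> conjugates \<open>\<tau>\<^sub>m\<close> by \<open>u\<close>
  itself modulo \<open>\<tau>\<^sub>m\<close>, and therefore \<open>u = 1\<close>. The last observation, applied with one more strand,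
  also shows that \<open>U\<^sub>m\<close> is free.\<close>

section \<open>Evaluation of words and two auxiliary groups\<close>

text \<open>Groups are written additively without being commutative: \<open>group_add\<close> is the
  class of arbitrary groups. In it the simplifier can normalise the values of words.\<close>

fun ev :: "('a \<Rightarrow> 'h::group_add) \<Rightarrow> 'a word \<Rightarrow> 'h" where
  "ev f [] = 0"
| "ev f ((a, e) # w) = (if e then f a else - f a) + ev f w"

lemma ev_append [simp]: "ev f (u @ v) = ev f u + ev f v"
  by (induction f u rule: ev.induct) (auto simp: add.assoc)

lemma ev_winv [simp]: "ev f (winv w) = - ev f w"
  by (induction f w rule: ev.induct) (auto simp: minus_add)

lemma pres_eq_imp_ev_eq:
  assumes "pres_eq A R u v"
    and "\<And>u v. (u, v) \<in> R \<Longrightarrow> u \<in> words A \<Longrightarrow> v \<in> words A \<Longrightarrow> ev f u = ev f v"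
  shows "ev f u = ev f v"
  using assms by (induction rule: pres_eq.induct) auto

definition hom_add :: "('h::group_add \<Rightarrow> 'k::group_add) \<Rightarrow> bool"
  where "hom_add \<phi> \<longleftrightarrow> (\<forall>a b. \<phi> (a + b) = \<phi> a + \<phi> b)"

lemma hom_add_add: "hom_add \<phi> \<Longrightarrow> \<phi> (a + b) = \<phi> a + \<phi> b"
  by (simp add: hom_add_def)

lemma hom_add_zero: "hom_add \<phi> \<Longrightarrow> \<phi> 0 = 0"
  using hom_add_add[of \<phi> 0 0] add_left_cancel[of "\<phi> 0" "\<phi> 0" 0] by simp

lemma hom_add_minus: "hom_add \<phi> \<Longrightarrow> \<phi> (- a) = - \<phi> a"
  using hom_add_add[of \<phi> a "- a"] by (simp add: hom_add_zero eq_neg_iff_add_eq_0 minus_unique)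

lemma hom_add_diff: "hom_add \<phi> \<Longrightarrow> \<phi> (a - b) = \<phi> a - \<phi> b"
  by (simp only: diff_conv_add_uminus hom_add_add hom_add_minus)

lemmas hom_add_simps = hom_add_add hom_add_zero hom_add_minus hom_add_diff

lemma hom_add_conj: "hom_add (\<lambda>a. - (c::'h::group_add) + a + c)"
  by (simp add: hom_add_def add.assoc)

lemma hom_add_ev: "hom_add \<phi> \<Longrightarrow> \<phi> (ev f w) = ev (\<phi> \<circ> f) w"
  by (induction f w rule: ev.induct) (auto simp: hom_add_simps)

section \<open>Permutation groups and Cayley's embedding\<close>

typedef 'a symg = "{f :: 'a \<Rightarrow> 'a. bij f}"
  morphisms ap Abs_symg
  by (auto intro: bij_id)

setup_lifting type_definition_symg

instantiation symg :: (type) group_add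
begin
lift_definition zero_symg :: "'a symg" is id by (rule bij_id)
lift_definition plus_symg :: "'a symg \<Rightarrow> 'a symg \<Rightarrow> 'a symg" is "(\<circ>)" by (rule bij_comp)
lift_definition uminus_symg :: "'a symg \<Rightarrow> 'a symg" is "inv_into UNIV" by (rule bij_imp_bij_inv)
definition minus_symg :: "'a symg \<Rightarrow> 'a symg \<Rightarrow> 'a symg" where "minus_symg a b = a + - b"
instance
proof
  show "- a + a = 0" for a :: "'a symg"
    by transfer (simp add: bij_is_inj)
qed (transfer; auto simp: minus_symg_def)+
end

lemma ap_zero [simp]: "ap 0 x = x"
  by transfer simp

lemma ap_add [simp]: "ap (a + b) x = ap a (ap b x)"
  by transfer simp

lemma ap_minus_cancel [simp]: "ap (- a) (ap a x) = x" "ap a (ap (- a) x) = x"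
  by (simp_all flip: ap_add)

lemma ap_Abs: "bij f \<Longrightarrow> ap (Abs_symg f) = f"
  by (simp add: Abs_symg_inverse)

lemma symg_eqI: "(\<And>x. ap a x = ap b x) \<Longrightarrow> a = b"
  by (metis ap_inject ext)

text \<open>Cayley's theorem: it turns a presented group into elements of a type of class
  \<^class>\<open>group_add\<close>, in which the simplifier can decide word identities.\<close>

lemma cayley:
  obtains \<phi> :: "'a \<Rightarrow> 'a word set symg"
  where "\<And>u v. u \<in> words A \<Longrightarrow> v \<in> words A \<Longrightarrow> pres_eq A R u v \<longleftrightarrow> ev \<phi> u = ev \<phi> v"
proof -
  interpret G: group "presented_group A R" by (rule group_presented_group)
  let ?C = "carrier (presented_group A R)"
  \<comment> \<open>Left multiplication is continued by the identity outside the carrier, so that it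
    permutes the whole type.\<close>
  define L where "L c = (\<lambda>X. if X \<in> ?C then c \<otimes>\<^bsub>presented_group A R\<^esub> X else X)" for c
  have bij: "bij (L c)" if "c \<in> ?C" for c
    by (rule o_bij[where g = "L (inv\<^bsub>presented_group A R\<^esub> c)"])
      (use that in \<open>auto simp: L_def fun_eq_iff G.inv_mult_cancel G.mult_inv_cancel\<close>)
  define \<phi> where "\<phi> a = Abs_symg (L (word_class A R [(a, True)]))" for a
  have C: "word_class A R w \<in> ?C" if "w \<in> words A" for w
    using that by (simp add: carrier_presented_group)
  have pos: "ap (\<phi> a) (word_class A R w) = word_class A R ((a, True) # w)"
    if "a \<in> A" "w \<in> words A" for a w
    using that C[of w] bij[OF C[of "[(a, True)]"]] word_class_mult[of "[(a, True)]" A w R]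
    by (simp add: \<phi>_def ap_Abs L_def)
  have neg: "ap (- \<phi> a) (word_class A R w) = word_class A R ((a, False) # w)"
    if "a \<in> A" "w \<in> words A" for a w
  proof -
    have "pres_eq A R ([(a, True), (a, False)] @ w) ([] @ w)"
      using that pres_eq.cancel[of a A R True] by (intro pres_eq.append) (auto intro: pres_eq.refl)
    then have "ap (\<phi> a) (word_class A R ((a, False) # w)) = word_class A R w"
      using that by (simp add: pos word_class_eq_iff)
    then show ?thesis by (metis ap_minus_cancel(1))
  qed
  have app: "ap (ev \<phi> u) (word_class A R w) = word_class A R (u @ w)"
    if "u \<in> words A" "w \<in> words A" for u w
    using that
  proof (induction u)
    case (Cons l u)
    obtain a e where l: "l = (a, e)" by fastforce
    show ?case
      using Cons pos[of a "u @ w"] neg[of a "u @ w"] by (cases e) (simp_all add: l)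
  qed simp
  \<comment> \<open>The image of the class of the empty word recovers the class of \<open>w\<close>;
    this gives faithfulness.\<close>
  have nil: "word_class A R w = ap (ev \<phi> w) (word_class A R [])" if "w \<in> words A" for w
    using app[OF that, of "[]"] by simp
  show thesis
  proof (rule that[of \<phi>])
    fix u v assume uv: "u \<in> words A" "v \<in> words A"
    have "ap (ev \<phi> u) X = ap (ev \<phi> v) X" if "pres_eq A R u v" for X
    proof (cases "X \<in> ?C")
      case True
      then obtain w where w: "w \<in> words A" "X = word_class A R w"
        by (auto simp: carrier_presented_group)
      have "pres_eq A R (u @ w) (v @ w)"
        using that w by (intro pres_eq.append) (auto intro: pres_eq.refl)
      then show ?thesis
        using uv w by (simp add: app word_class_eq_iff)
    next
      case False
      have fix1: "ap (\<phi> a) X = X" if "a \<in> A" for a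
        using False bij[OF C[of "[(a, True)]"]] that by (simp add: \<phi>_def ap_Abs L_def)
      have fix2: "ap (- \<phi> a) X = X" if "a \<in> A" for a
        using fix1[OF that] ap_minus_cancel(1)[of "\<phi> a" X] by simp
      have "ap (ev \<phi> w) X = X" if "w \<in> words A" for w
        using that
      proof (induction w)
        case (Cons l w)
        obtain a e where l: "l = (a, e)" by fastforce
        show ?case using Cons fix1[of a] fix2[of a] by (cases e) (simp_all add: l)
      qed simp
      then show ?thesis using uv by simp
    qed
    then have "pres_eq A R u v \<Longrightarrow> ev \<phi> u = ev \<phi> v"
      by (intro symg_eqI)
    moreover have "pres_eq A R u v" if "ev \<phi> u = ev \<phi> v"
      using uv nil[of u] nil[of v] that by (simp add: word_class_eq_iff[symmetric])
    ultimately show "pres_eq A R u v \<longleftrightarrow> ev \<phi> u = ev \<phi> v"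
      by blast
  qed
qed

section \<open>Free groups and their universal property\<close>

abbreviation free_eq :: "'a word \<Rightarrow> 'a word \<Rightarrow> bool" where "free_eq \<equiv> pres_eq UNIV {}"

lemma words_UNIV [simp]: "w \<in> words UNIV"
  by (auto simp: words_def)

quotient_type 'a fg = "'a word" / free_eq
proof (rule equivpI)
  show "reflp free_eq" by (auto intro!: reflpI pres_eq.refl)
  show "symp free_eq" by (auto intro!: sympI pres_eq.sym)
  show "transp free_eq" by (auto intro!: transpI elim: pres_eq.trans)
qed

text \<open>In Cayley's embedding \<open>winv\<close> becomes negation, which respects
  equality.\<close>

lemma free_eq_winv:
  assumes "free_eq u v"
  shows "free_eq (winv u) (winv v)"
proof (rule cayley[of UNIV "{}"])
  fix \<phi> :: "'a \<Rightarrow> 'a word set symg"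
  assume *: "\<And>u v. u \<in> words UNIV \<Longrightarrow> v \<in> words UNIV \<Longrightarrow> free_eq u v \<longleftrightarrow> ev \<phi> u = ev \<phi> v"
  have "ev \<phi> u = ev \<phi> v" using *[OF words_UNIV words_UNIV] assms by blast
  then have "ev \<phi> (winv u) = ev \<phi> (winv v)" by (simp only: ev_winv)
  then show ?thesis using *[OF words_UNIV words_UNIV] by blast
qed

instantiation fg :: (type) group_add
begin
lift_definition zero_fg :: "'a fg" is "[]" .
lift_definition plus_fg :: "'a fg \<Rightarrow> 'a fg \<Rightarrow> 'a fg" is "(@)" by (rule pres_eq.append)
lift_definition uminus_fg :: "'a fg \<Rightarrow> 'a fg" is winv by (rule free_eq_winv)
definition minus_fg :: "'a fg \<Rightarrow> 'a fg \<Rightarrow> 'a fg" where "minus_fg a b = a + - b"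
instance
proof
  fix a b c :: "'a fg"
  show "a + b + c = a + (b + c)" by transfer (simp add: pres_eq.refl)
  show "0 + a = a" by transfer (simp add: pres_eq.refl)
  show "a + 0 = a" by transfer (simp add: pres_eq.refl)
  show "- a + a = 0" by transfer (rule pres_eq_winv, simp)
  show "a + - b = a - b" by (simp add: minus_fg_def)
qed
end

lift_definition fg_gen :: "'a \<Rightarrow> 'a fg" is "\<lambda>a. [(a, True)]" .

lift_definition fev :: "('a \<Rightarrow> 'h::group_add) \<Rightarrow> 'a fg \<Rightarrow> 'h" is ev
  by (rule pres_eq_imp_ev_eq) auto

lemma fev_gen [simp]: "fev f (fg_gen a) = f a"
  by transfer simp

lemma fev_hom: "hom_add (fev f)"
  unfolding hom_add_def by (intro allI, transfer) simp

lemma fev_simps [simp]: "fev f (a + b) = fev f a + fev f b" "fev f 0 = 0" "fev f (- a) = - fev f a"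
  "fev f (a - b) = fev f a - fev f b"
  by (simp_all add: hom_add_simps[OF fev_hom])

lemma fev_ev [simp]: "fev f (ev fg_gen w) = ev f w"
  using hom_add_ev[OF fev_hom, of f fg_gen w] by (simp add: comp_def)

text \<open>Reduces claims about elements of the free group to claims about words.\<close>

lemma ev_fg_gen_surj: "\<exists>w. ev fg_gen w = x"
proof -
  have "ev fg_gen w = abs_fg w" for w :: "'a word"
  proof (induction w)
    case (Cons l w)
    obtain a e where l: "l = (a, e)" by fastforce
    have "(if e then fg_gen a else - fg_gen a) = abs_fg [(a, e)]"
      by (simp add: fg_gen.abs_eq uminus_fg.abs_eq)
    then show ?case using Cons by (simp add: l plus_fg.abs_eq)
  qed (simp add: zero_fg_def)
  then show ?thesis by (metis Quotient3_abs_rep Quotient3_fg)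
qed

lemma fev_comp: "hom_add \<phi> \<Longrightarrow> \<phi> (fev f x) = fev (\<phi> \<circ> f) x"
  using ev_fg_gen_surj[of x] by (auto simp: hom_add_ev)

section \<open>Reduced words and centralizers in free groups\<close>

fun push :: "'a \<times> bool \<Rightarrow> 'a word \<Rightarrow> 'a word" where
  "push l [] = [l]"
| "push l (k # w) = (if fst k = fst l \<and> snd k \<noteq> snd l then w else l # k # w)"

fun reduced :: "'a word \<Rightarrow> bool" where
  "reduced (k # l # w) \<longleftrightarrow> \<not> (fst k = fst l \<and> snd k \<noteq> snd l) \<and> reduced (l # w)"
| "reduced _ \<longleftrightarrow> True"

lemma reduced_Cons: "reduced (k # w) \<longleftrightarrow> (w = [] \<or> \<not> (fst k = fst (hd w) \<and> snd k \<noteq> snd (hd w))) \<and> reduced w"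
  by (cases w) auto

lemma reduced_push: "reduced w \<Longrightarrow> reduced (push l w)"
  by (cases w) (auto simp: reduced_Cons)

lemma reduced_foldr_push: "reduced w \<Longrightarrow> reduced (foldr push u w)"
  by (induction u) (auto simp: reduced_push)

lemma push_push: "reduced w \<Longrightarrow> push (a, e) (push (a, \<not> e) w) = w"
  by (cases w rule: remdups_adj.cases) (auto simp: reduced_Cons prod_eq_iff)

text \<open>Van der Waerden's argument: letters act on reduced words by \<open>push\<close>, and
  inverse letters act inversely by \<open>push_push\<close>. Applied to the empty word, this makes
  reduced forms unique.\<close>

lemma free_eq_foldr_push: "free_eq u v \<Longrightarrow> reduced w \<Longrightarrow> foldr push u w = foldr push v w"
proof (induction arbitrary: w rule: pres_eq.induct)
  case (append u v u' v')
  then show ?case using reduced_foldr_push[of w] by simp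
qed (auto simp: push_push)

lemma foldr_push_reduced: "reduced w \<Longrightarrow> foldr push w [] = w"
proof (induction w)
  case (Cons k w)
  then show ?case by (cases w) (auto simp: reduced_Cons)
qed simp

lemma free_eq_push: "free_eq (l # w) (push l w)"
proof (cases w)
  case (Cons k v)
  show ?thesis
  proof (cases "fst k = fst l \<and> snd k \<noteq> snd l")
    case True
    then have "k = (fst l, \<not> snd l)" by (auto simp: prod_eq_iff)
    then have "free_eq ([l, k] @ v) ([] @ v)"
      using pres_eq.cancel[of "fst l" UNIV "{}" "snd l"]
      by (intro pres_eq.append) (auto intro: pres_eq.refl)
    then show ?thesis using True Cons by simp
  qed (auto simp: Cons intro: pres_eq.refl)
qed (auto intro: pres_eq.refl)

lemma free_eq_foldr: "free_eq u (foldr push u [])"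
proof (induction u)
  case (Cons l u)
  have "free_eq ([l] @ u) ([l] @ foldr push u [])"
    using Cons by (intro pres_eq.append) (auto intro: pres_eq.refl)
  then show ?case using pres_eq.trans[OF _ free_eq_push[of l "foldr push u []"]] by simp
qed (auto intro: pres_eq.refl)

lemma reduced_append:
  "reduced u \<Longrightarrow> u \<noteq> [] \<Longrightarrow> \<not> (fst (last u) = fst l \<and> snd (last u) \<noteq> snd l) \<Longrightarrow> reduced (u @ [l])"
proof (induction u)
  case (Cons k u)
  then show ?case by (cases u) auto
qed simp

text \<open>If a nonempty reduced word \<open>w\<close> commutes with a letter \<open>l\<close> such that \<open>l w\<close> and \<open>w l\<close> are
  reduced, then \<open>w\<close> begins with \<open>l\<close>. Two distinct generators and their inverses provide a letter
  for which this fails.\<close>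

lemma fg_centralizer:
  fixes x :: "'a fg"
  assumes "a \<noteq> b" and a: "x + fg_gen a = fg_gen a + x" and b: "x + fg_gen b = fg_gen b + x"
  shows "x = 0"
proof -
  obtain u where u: "x = abs_fg u" by (metis Quotient3_abs_rep Quotient3_fg)
  define w where "w = foldr push u []"
  have x: "x = abs_fg w"
    using free_eq_foldr[of u] by (simp add: w_def u fg.abs_eq_iff)
  have red: "reduced w" by (simp add: w_def reduced_foldr_push)
  have comm: "free_eq (w @ [l]) (l # w)" if "fst l = a \<or> fst l = b" for l
  proof -
    have *: "x + abs_fg [l] = abs_fg [l] + x"
    proof (cases "snd l")
      case True
      then have "l = (a, True) \<or> l = (b, True)" using that by (auto simp: prod_eq_iff)
      then show ?thesis using a b by (auto simp: fg_gen.abs_eq)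
    next
      case False
      then have "l = (a, False) \<or> l = (b, False)" using that by (auto simp: prod_eq_iff)
      moreover have "abs_fg [(c, False)] = - fg_gen c" for c :: 'a
        by (simp add: fg_gen.abs_eq uminus_fg.abs_eq)
      moreover have "x + - y = - y + x" if "x + y = y + x" for y
        using that by (metis add.assoc add_minus_cancel minus_add_cancel add_0_right right_minus)
      ultimately show ?thesis using a b by auto
    qed
    then show ?thesis by (simp add: x plus_fg.abs_eq fg.abs_eq_iff)
  qed
  have "w = []"
  proof (rule ccontr)
    assume ne: "w \<noteq> []"
    define h where "h = hd w"
    define t where "t = last w"
    \<comment> \<open>Choosing the generator that does not occur in \<open>h\<close> prevents
      equality and cancellation at the front; taking the exponent of \<open>t\<close> prevents
      cancellation at the end.\<close>
    obtain l where l: "fst l = a \<or> fst l = b" "l \<noteq> h" "\<not> (fst l = fst h \<and> snd l \<noteq> snd h)"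
      "\<not> (fst t = fst l \<and> snd t \<noteq> snd l)"
    proof (cases "fst h = a")
      case True
      show thesis
        by (rule that[of "(b, snd t)"]) (use True \<open>a \<noteq> b\<close> in \<open>auto\<close>)
    next
      case False
      show thesis
        by (rule that[of "(a, snd t)"]) (use False in \<open>auto\<close>)
    qed
    have "reduced (w @ [l])" "reduced (l # w)"
      using red ne l by (auto intro!: reduced_append simp: reduced_Cons h_def t_def)
    then have "w @ [l] = l # w"
      using free_eq_foldr_push[OF comm[OF l(1)], of "[]"] foldr_push_reduced[of "w @ [l]"]
        foldr_push_reduced[of "l # w"] by simp
    then show False using l(2) ne h_def by (metis hd_append2 list.sel(1))
  qed
  then show ?thesis by (simp add: x zero_fg_def)
qed

section \<open>The action on tuples\<close>

fun gen_less :: "braid_gen \<Rightarrow> braid_gen \<Rightarrow> bool" where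
  "gen_less (Z_gen i) (Z_gen j) \<longleftrightarrow> i < j"
| "gen_less (Z_gen i) (X_gen r) \<longleftrightarrow> True"
| "gen_less (X_gen s) (X_gen r) \<longleftrightarrow> s < r"
| "gen_less _ _ \<longleftrightarrow> False"

fun gen_pair :: "braid_gen \<Rightarrow> braid_gen \<Rightarrow> bool" where
  "gen_pair (X_gen s) (X_gen r) \<longleftrightarrow> handle_pair s r"
| "gen_pair _ _ \<longleftrightarrow> False"

fun is_loop :: "braid_gen \<Rightarrow> bool" where
  "is_loop (Sigma_gen i) \<longleftrightarrow> False"
| "is_loop _ \<longleftrightarrow> True"

lemma gen_less_irrefl [simp]: "\<not> gen_less a a"
  by (cases a) auto

lemma gen_less_not_sym: "gen_less a b \<Longrightarrow> \<not> gen_less b a"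
  by (cases a; cases b) auto

lemma gen_less_trans: "gen_less a b \<Longrightarrow> gen_less b c \<Longrightarrow> gen_less a c"
  by (cases a; cases b; cases c) auto

lemma gen_less_linear: "is_loop a \<Longrightarrow> is_loop b \<Longrightarrow> gen_less a b \<or> a = b \<or> gen_less b a"
  by (cases a; cases b) auto

lemma gen_less_is_loop: "gen_less a b \<Longrightarrow> is_loop a \<and> is_loop b"
  by (cases a; cases b) auto

lemma gen_pair_less: "gen_pair a b \<Longrightarrow> gen_less a b"
  by (cases a; cases b) (auto simp: handle_pair_def)

lemma gen_pair_irrefl [simp]: "\<not> gen_pair a a"
  using gen_pair_less by fastforce

lemma handle_pair_iff: "handle_pair s r \<longleftrightarrow> odd s \<and> r = Suc s"
proof
  assume "odd s \<and> r = Suc s"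
  then show "handle_pair s r"
    unfolding handle_pair_def by (intro exI[of _ "r div 2"]) (auto elim!: oddE)
qed (auto simp: handle_pair_def)

lemma gen_pair_unique:
  "gen_pair a b \<Longrightarrow> gen_pair a c \<longleftrightarrow> c = b"
  "gen_pair b a \<Longrightarrow> gen_pair c a \<longleftrightarrow> c = b"
  "gen_pair a b \<Longrightarrow> \<not> gen_pair b c"
  by (cases a; cases b; cases c; auto simp: handle_pair_iff)+

text \<open>The members of a pair have consecutive indices, so no third generator lies between
  them.\<close>

lemma gen_pair_adjacent:
  assumes "gen_pair b a" "c \<noteq> a" "c \<noteq> b"
  shows "gen_less c a \<longleftrightarrow> gen_less c b" "gen_less a c \<longleftrightarrow> gen_less b c"
  using assms by (cases a; cases b; cases c; auto simp: handle_pair_iff)+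

text \<open>A tuple gives the values of \<open>\<tau>\<^sub>i\<close>, \<open>w\<^sub>r\<close>, \<open>\<xi>\<^sub>j\<close> at \<open>Sigma_gen i\<close>, \<open>X_gen r\<close>, \<open>Z_gen j\<close>, so the
  letters of \<open>U\<^sub>m\<^sub>-\<^sub>1\<close> are \<^term>\<open>braid_gens m g p\<close>. It amounts to a homomorphism from a free group,
  and precomposition turns the right action on that group into a left action on tuples.
  Ordering the \<open>\<xi>\<^sub>j\<close> before the \<open>w\<^sub>r\<close> lets \<open>x\<^sub>r\<close> and \<open>z\<^sub>j\<close> be treated by the same formulas.\<close>

type_synonym 'h tuple = "braid_gen \<Rightarrow> 'h"

definition sig_act :: "nat \<Rightarrow> 'h::group_add tuple \<Rightarrow> 'h tuple"
  where "sig_act i f = f(Sigma_gen i := f (Sigma_gen i) + f (Sigma_gen (Suc i)) - f (Sigma_gen i),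
    Sigma_gen (Suc i) := f (Sigma_gen i))"

definition sig_inv :: "nat \<Rightarrow> 'h::group_add tuple \<Rightarrow> 'h tuple"
  where "sig_inv i f = f(Sigma_gen i := f (Sigma_gen (Suc i)),
    Sigma_gen (Suc i) := - f (Sigma_gen (Suc i)) + f (Sigma_gen i) + f (Sigma_gen (Suc i)))"

definition loop_act :: "braid_gen \<Rightarrow> 'h::group_add tuple \<Rightarrow> 'h tuple"
  where "loop_act a f = (\<lambda>c. let t = f (Sigma_gen 1); y = f a in
    if c = Sigma_gen 1 then - t + y + t - y + t
    else if c = a then - t + y + t
    else if gen_pair c a then - t + y + t - y + f c + t
    else if gen_less c a then - (y - t - y + t) + f c + (y - t - y + t)
    else if gen_pair a c then - t + f c
    else f c)"

text \<open>Computed from the image of a tuple with old values \<open>t\<close> and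
  \<open>y\<close>, the local \<open>q\<close> equals \<open>- y + t\<close>. Conjugation by it
  recovers the old \<open>t\<close>, and then \<open>y = t - q\<close>.\<close>

definition loop_inv :: "braid_gen \<Rightarrow> 'h::group_add tuple \<Rightarrow> 'h tuple"
  where "loop_inv a f = (\<lambda>c. let q = - f a + f (Sigma_gen 1); t = q + f (Sigma_gen 1) - q; y = t - q in
    if c = Sigma_gen 1 then t
    else if c = a then y
    else if gen_pair c a then - (- t + y + t - y) + f c - t
    else if gen_less c a then y - t - y + t + f c - (y - t - y + t)
    else if gen_pair a c then t + f c
    else f c)"

text \<open>Brings expressions into the form of right-nested sums in which adjacent inverses cancel,
  which decides identities valid in all groups. The rule \<open>add_uminus_conv_diff\<close>
  rewrites in the opposite direction and is therefore deleted.\<close>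

lemmas group_norm = add.assoc minus_add diff_conv_add_uminus

lemma sig_inverse:
  "sig_inv i (sig_act i f) = f" "sig_act i (sig_inv i f) = f"
  by (auto simp: sig_act_def sig_inv_def fun_eq_iff group_norm simp del: add_uminus_conv_diff)

lemma loop_act_simps:
  "is_loop a \<Longrightarrow> loop_act a f (Sigma_gen 1) = - f (Sigma_gen 1) + f a + f (Sigma_gen 1) - f a + f (Sigma_gen 1)"
  "is_loop a \<Longrightarrow> loop_act a f (Sigma_gen (Suc 0)) = - f (Sigma_gen 1) + f a + f (Sigma_gen 1) - f a + f (Sigma_gen 1)"
  "is_loop a \<Longrightarrow> i \<noteq> 1 \<Longrightarrow> loop_act a f (Sigma_gen i) = f (Sigma_gen i)"
  "is_loop a \<Longrightarrow> loop_act a f a = - f (Sigma_gen 1) + f a + f (Sigma_gen 1)"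
  "gen_pair c a \<Longrightarrow> loop_act a f c = - f (Sigma_gen 1) + f a + f (Sigma_gen 1) - f a + f c + f (Sigma_gen 1)"
  "gen_less c a \<Longrightarrow> \<not> gen_pair c a \<Longrightarrow> loop_act a f c =
    - (f a - f (Sigma_gen 1) - f a + f (Sigma_gen 1)) + f c + (f a - f (Sigma_gen 1) - f a + f (Sigma_gen 1))"
  "gen_pair a c \<Longrightarrow> loop_act a f c = - f (Sigma_gen 1) + f c"
  "gen_less a c \<Longrightarrow> \<not> gen_pair a c \<Longrightarrow> loop_act a f c = f c"
  using gen_less_is_loop gen_less_not_sym gen_pair_less
  by (auto simp: loop_act_def Let_def) (metis gen_less_irrefl gen_less_not_sym is_loop.simps(1) gen_pair.simps)+

lemma loop_inverse:
  assumes "is_loop a"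
  shows "loop_inv a (loop_act a f) = f" "loop_act a (loop_inv a f) = f"
proof -
  have a: "a \<noteq> Sigma_gen 1" "a \<noteq> Sigma_gen (Suc 0)" using assms by auto
  show "loop_inv a (loop_act a f) = f"
    using a by (auto simp: loop_act_def loop_inv_def Let_def fun_eq_iff group_norm simp del: add_uminus_conv_diff)
  show "loop_act a (loop_inv a f) = f"
    using a by (auto simp: loop_act_def loop_inv_def Let_def fun_eq_iff group_norm simp del: add_uminus_conv_diff)
qed

definition act :: "braid_gen \<Rightarrow> 'h::group_add tuple symg"
  where "act a = Abs_symg (case a of Sigma_gen i \<Rightarrow> sig_act i | _ \<Rightarrow> loop_act a)"

lemma bij_sig_act: "bij (sig_act i)"
  by (rule o_bij[of "sig_inv i"]) (auto simp: fun_eq_iff sig_inverse)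

lemma bij_loop_act: "is_loop a \<Longrightarrow> bij (loop_act a)"
  by (rule o_bij[of "loop_inv a"]) (auto simp: fun_eq_iff loop_inverse)

lemma ap_act_sigma [simp]: "ap (act (Sigma_gen i)) f = sig_act i f"
  by (simp add: act_def ap_Abs bij_sig_act)

lemma ap_act_loop: "is_loop a \<Longrightarrow> ap (act a) f = loop_act a f"
  by (cases a) (simp_all add: act_def ap_Abs bij_loop_act)

lemma ap_act_loops [simp]: "ap (act (X_gen r)) f = loop_act (X_gen r) f" "ap (act (Z_gen r)) f = loop_act (Z_gen r) f"
  by (simp_all add: ap_act_loop)

lemma ap_act_sigma_minus [simp]: "ap (- act (Sigma_gen i)) f = sig_inv i f"
  by (metis ap_act_sigma ap_minus_cancel(1) sig_inverse(2))

text \<open>All new entries are group words in the old ones. This lets the action on free generators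
  be specialised to any group.\<close>

lemma act_natural:
  assumes "hom_add \<phi>"
  shows "ap (act a) (\<phi> \<circ> f) = \<phi> \<circ> ap (act a) f"
proof (cases "is_loop a")
  case True
  then show ?thesis
    by (auto simp: ap_act_loop loop_act_def fun_eq_iff Let_def hom_add_simps[OF assms])
next
  case False
  then obtain i where "a = Sigma_gen i" by (cases a) auto
  then show ?thesis
    by (auto simp: sig_act_def fun_eq_iff hom_add_simps[OF assms])
qed

lemma act_word_natural:
  assumes "hom_add \<phi>"
  shows "ap (ev act w) (\<phi> \<circ> f) = \<phi> \<circ> ap (ev act w) f"
proof (induction w)
  case (Cons l w)
  have "ap (- act a) (\<phi> \<circ> h) = \<phi> \<circ> ap (- act a) h" for a h
    using act_natural[OF assms, of a "ap (- act a) h"] by (metis ap_minus_cancel)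
  then show ?case using Cons act_natural[OF assms]
    by (cases l) (simp del: o_apply add: Cons)
qed simp

lemma sig_act_simps:
  "sig_act i f (Sigma_gen i) = f (Sigma_gen i) + f (Sigma_gen (Suc i)) - f (Sigma_gen i)"
  "sig_act i f (Sigma_gen (Suc i)) = f (Sigma_gen i)"
  "j \<noteq> i \<Longrightarrow> j \<noteq> Suc i \<Longrightarrow> sig_act i f (Sigma_gen j) = f (Sigma_gen j)"
  "is_loop c \<Longrightarrow> sig_act i f c = f c"
  by (auto simp: sig_act_def)

lemma sig_inv_simps:
  "sig_inv i f (Sigma_gen i) = f (Sigma_gen (Suc i))"
  "sig_inv i f (Sigma_gen (Suc i)) = - f (Sigma_gen (Suc i)) + f (Sigma_gen i) + f (Sigma_gen (Suc i))"
  "j \<noteq> i \<Longrightarrow> j \<noteq> Suc i \<Longrightarrow> sig_inv i f (Sigma_gen j) = f (Sigma_gen j)"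
  "is_loop c \<Longrightarrow> sig_inv i f c = f c"
  by (auto simp: sig_inv_def)

lemmas tuple_simps = loop_act_simps sig_act_simps sig_inv_simps numeral_2_eq_2

lemma gen_cases:
  obtains i where "c = Sigma_gen i" | "is_loop c"
  by (cases c) auto

section \<open>The defining relations hold for the action on tuples\<close>

lemma sig_braid: "sig_act i (sig_act (Suc i) (sig_act i f)) = sig_act (Suc i) (sig_act i (sig_act (Suc i) f))"
  by (auto simp: sig_act_def fun_eq_iff group_norm simp del: add_uminus_conv_diff)

lemma sig_commute:
  "Suc i < j \<or> Suc j < i \<Longrightarrow> sig_act i (sig_act j f) = sig_act j (sig_act i f)"
  by (auto simp: sig_act_def fun_eq_iff)

lemma loop_sig_commute:
  assumes "is_loop a" "i > 1"
  shows "loop_act a (sig_act i f) = sig_act i (loop_act a f)"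
  using assms by (cases a) (auto simp: loop_act_def sig_act_def fun_eq_iff Let_def)

text \<open>The entry at \<open>c\<close> is a word whose shape depends only on the position of
  \<open>c\<close> relative to \<open>a\<close>; in each position both sides have the same normal
  form.\<close>

lemma loop_loop_same:
  assumes a: "is_loop a"
  shows "sig_inv 1 (loop_act a (sig_inv 1 (loop_act a f))) = loop_act a (sig_inv 1 (loop_act a (sig_inv 1 f)))"
    (is "?l = ?r")
proof
  fix c
  show "?l c = ?r c"
  proof (cases c rule: gen_cases)
    case (1 i)
    consider "i = 1" | "i = 2" | "i \<noteq> 1" "i \<noteq> 2" by auto
    then show ?thesis
      by cases (use 1 a in \<open>simp_all add: tuple_simps group_norm del: add_uminus_conv_diff\<close>)
  next
    case 2
    then consider "c = a" | "gen_pair c a" | "gen_less c a" "\<not> gen_pair c a"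
      | "gen_pair a c" | "gen_less a c" "\<not> gen_pair a c"
      using gen_less_linear[of a c] a by blast
    then show ?thesis
      by cases (use 2 a in \<open>simp_all add: tuple_simps group_norm del: add_uminus_conv_diff\<close>)
  qed
qed

text \<open>In each position the formulas of both loops at \<open>c\<close> are determined. Other
  combinations would put a third generator between the members of a pair.\<close>

lemma two_loops_cases:
  assumes "gen_less b a" "\<not> gen_pair b a" "is_loop c"
  obtains "c = a" | "c = b"
    | "gen_pair c b" "gen_less c a" "\<not> gen_pair c a"
    | "gen_less c b" "\<not> gen_pair c b" "gen_less c a" "\<not> gen_pair c a"
    | "gen_pair b c" "gen_less c a" "\<not> gen_pair c a"
    | "gen_less b c" "\<not> gen_pair b c" "gen_pair c a"
    | "gen_less b c" "\<not> gen_pair b c" "gen_less c a" "\<not> gen_pair c a"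
    | "gen_less b c" "\<not> gen_pair b c" "gen_pair a c"
    | "gen_less b c" "\<not> gen_pair b c" "gen_less a c" "\<not> gen_pair a c"
proof -
  have loop: "is_loop a" "is_loop b" and "\<not> gen_less a b"
    using assms(1) gen_less_is_loop gen_less_not_sym by blast+
  consider "c = a" | "c = b" | "c \<noteq> a" "c \<noteq> b" "gen_less c b"
    | "c \<noteq> a" "c \<noteq> b" "gen_less b c" "gen_pair b c"
    | "c \<noteq> a" "c \<noteq> b" "gen_less b c" "\<not> gen_pair b c"
    using gen_less_linear[OF loop(2) assms(3)] by blast
  then show thesis
  proof cases
    case 3
    then have "gen_less c a" "\<not> gen_less b c"
      using assms(1) gen_less_trans gen_less_not_sym by blast+
    moreover have "\<not> gen_pair c a"
      using gen_pair_adjacent(1)[of c a b] assms(1) 3 \<open>\<not> gen_less b c\<close> by (cases "b = a") auto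
    ultimately show thesis using 3 that(3,4) by blast
  next
    case 4
    then have "\<not> gen_less a c"
      using gen_pair_adjacent(1)[of b c a] \<open>\<not> gen_less a b\<close> assms(1) by (cases "a = b") auto
    then have "gen_less c a" using gen_less_linear[OF loop(1) assms(3)] 4 by blast
    then show thesis using 4 that(5) gen_pair_unique(3) by blast
  next
    case 5
    then show thesis using that(6-9) gen_less_linear[OF loop(1) assms(3)] by blast
  qed (use that in blast)+
qed

text \<open>Covers three families of relations at once: two unpaired x, a z with an x, and two
  z.\<close>

lemma loop_loop_less:
  assumes ba: "gen_less b a" "\<not> gen_pair b a"
  shows "sig_inv 1 (loop_act b (sig_act 1 (loop_act a f))) = loop_act a (sig_inv 1 (loop_act b (sig_act 1 f)))"
    (is "?l = ?r")
proof
  have loop: "is_loop a" "is_loop b" using gen_less_is_loop[OF ba(1)] by auto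
  fix c
  show "?l c = ?r c"
  proof (cases c rule: gen_cases)
    case (1 i)
    consider "i = 1" | "i = 2" | "i \<noteq> 1" "i \<noteq> 2" by auto
    then show ?thesis
      by cases (use 1 loop ba in \<open>simp_all add: tuple_simps group_norm del: add_uminus_conv_diff\<close>)
  next
    case 2
    show ?thesis
      by (cases rule: two_loops_cases[OF ba 2])
        (use 2 loop ba in \<open>simp_all add: tuple_simps group_norm del: add_uminus_conv_diff\<close>)
  qed
qed

lemma loop_loop_pair:
  assumes ba: "gen_pair b a"
  shows "sig_inv 1 (loop_act b (sig_inv 1 (loop_act a f))) = loop_act a (sig_inv 1 (loop_act b (sig_act 1 f)))"
    (is "?l = ?r")
proof
  have loop: "is_loop a" "is_loop b" using gen_less_is_loop[OF gen_pair_less[OF ba(1)]] by auto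
  fix c
  show "?l c = ?r c"
  proof (cases c rule: gen_cases)
    case (1 i)
    consider "i = 1" | "i = 2" | "i \<noteq> 1" "i \<noteq> 2" by auto
    then show ?thesis
      by cases (use 1 loop ba in \<open>simp_all add: tuple_simps group_norm del: add_uminus_conv_diff\<close>)
  next
    case 2
    consider "c = a" | "c = b"
      | "gen_less c b" "\<not> gen_pair c b" "gen_less c a" "\<not> gen_pair c a"
      | "gen_less b c" "\<not> gen_pair b c" "gen_less a c" "\<not> gen_pair a c"
      using gen_less_linear[OF 2 loop(2)] gen_pair_adjacent[OF ba, of c]
        gen_pair_unique(1)[OF ba, of c] gen_pair_unique(2)[OF ba, of c]
        gen_pair_unique(3)[OF ba, of c] gen_pair_unique(3)[of c b a] ba
      by blast
    then show ?thesis
      by cases (use 2 loop ba in \<open>simp_all add: tuple_simps group_norm del: add_uminus_conv_diff\<close>)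
  qed
qed

lemma ap_diff [simp]: "ap (a - b) x = ap a (ap (- b) x)"
  by (simp only: diff_conv_add_uminus ap_add)

lemma act_rels:
  assumes "(u, v) \<in> braid_rels n g p"
  shows "ev act u = ev act v"
proof (rule symg_eqI)
  fix f :: "'h::group_add tuple"
  show "ap (ev act u) f = ap (ev act v) f"
    using assms unfolding braid_rels_def Un_iff mem_Collect_eq
    by (elim disjE exE conjE)
      (simp_all add: sig_braid sig_commute loop_sig_commute loop_loop_same[simplified]
        loop_loop_less[simplified] loop_loop_pair[simplified] handle_pair_iff)
qed

lemma act_pres_eq: "pres_eq (braid_gens n g p) (braid_rels n g p) u v \<Longrightarrow> ev act u = ev act v"
  by (erule pres_eq_imp_ev_eq) (rule act_rels)

section \<open>The free subgroup inside the braid group\<close>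

context
  fixes s y :: "'h::group_add"
  assumes same: "(- s + y - s) + y = y + (- s + y - s)"
begin

text \<open>With \<open>q = - s + y - s\<close>, both \<open>s + (y + q)\<close> and
  \<open>(y + q) + s\<close> equal \<open>y - s + y\<close>. So \<open>y + q\<close> commutes with
  \<open>s + s\<close>, and conjugating the latter by \<open>y\<close> is the same as conjugating it
  by \<open>- q\<close>.\<close>

lemma conj_square: "- y + (s + s) + y = - s + y + s + s - y + s"
proof -
  define q where "q = - s + y - s"
  have "s + (y + q) = s + (q + y)" using same by (simp add: q_def)
  also have "\<dots> = (y + q) + s"
    by (simp add: q_def group_norm del: add_uminus_conv_diff)
  finally have "s + (y + q) = (y + q) + s" .
  then have "s + s + (y + q) = (y + q) + (s + s)" by (metis add.assoc)
  then have "- y + (s + s) + y + q = q + (s + s)"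
    by (simp add: group_norm del: add_uminus_conv_diff)
  then have "- y + (s + s) + y = q + (s + s) - q" by (simp add: eq_diff_eq)
  then show ?thesis by (simp add: q_def group_norm del: add_uminus_conv_diff)
qed

lemma conj_self: "- y + (s + y - s) + y = - (s + s) + (s + y - s) + (s + s)"
proof -
  have "- y + (s + y - s) + y = - y + (s + s) + ((- s + y - s) + y)"
    by (simp add: group_norm del: add_uminus_conv_diff)
  also have "\<dots> = (- y + (s + s) + y) + (- s + y - s)"
    by (subst same) (simp add: add.assoc)
  also have "\<dots> = - (s + s) + (s + y - s) + (s + s)"
    unfolding conj_square by (simp add: group_norm del: add_uminus_conv_diff)
  finally show ?thesis .
qed

text \<open>Write \<open>s + x - s\<close> as the conjugate of \<open>- s + x + s\<close> by
  \<open>s + s\<close>. The inner element commutes with \<open>y\<close>, so only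
  \<open>s + s\<close> changes, as computed in \<open>conj_square\<close>.\<close>

lemma conj_less:
  assumes x: "(- s + x + s) + y = y + (- s + x + s)"
  defines "t \<equiv> s + s" and "w \<equiv> s + y - s"
  shows "- y + (s + x - s) + y = - (w - t - w + t) + (s + x - s) + (w - t - w + t)"
proof -
  define q where "q = - s + x + s"
  define T where "T = - y + (s + s) + y"
  have T: "T = - s + y + s + s - y + s"
    by (simp add: T_def conj_square)
  have "- y + (s + x - s) + y = - y + (s + s) + q - (s + s) + y"
    by (simp add: q_def group_norm del: add_uminus_conv_diff)
  also have "\<dots> = T + (- y + q + y) - T"
    by (simp add: T_def group_norm del: add_uminus_conv_diff)
  also have "- y + q + y = q"
    using x by (simp add: q_def add.assoc)
  also have "T + q - T = - (w - t - w + t) + (s + x - s) + (w - t - w + t)"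
    by (simp add: T q_def t_def w_def group_norm del: add_uminus_conv_diff)
  finally show ?thesis .
qed

lemma conj_pair_less:
  assumes x: "(- s + x - s) + y = y + (- s + x + s)"
  defines "t \<equiv> s + s" and "w \<equiv> s + y - s"
  shows "- y + (s + x - s) + y = - t + w + t - w + (s + x - s) + t"
proof -
  have "- y + (s + x - s) + y = - y + (s + s) + ((- s + x - s) + y)"
    by (simp add: group_norm del: add_uminus_conv_diff)
  also have "\<dots> = (- y + (s + s) + y) + (- s + x + s)"
    by (subst x) (simp add: add.assoc)
  also have "\<dots> = - t + w + t - w + (s + x - s) + t"
    unfolding conj_square t_def w_def by (simp add: group_norm del: add_uminus_conv_diff)
  finally show ?thesis .
qed

end

lemma conj_greater:
  fixes s x y :: "'h::group_add"
  assumes "(- s + y + s) + x = x + (- s + y + s)"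
  shows "- y + (s + x - s) + y = s + x - s"
proof -
  have "- y + (s + x - s) + y = - y + s + (x + (- s + y + s)) - s"
    by (simp add: group_norm del: add_uminus_conv_diff)
  also have "\<dots> = s + x - s"
    by (subst assms[symmetric]) (simp add: group_norm del: add_uminus_conv_diff)
  finally show ?thesis .
qed

lemma conj_pair_greater:
  fixes s x y :: "'h::group_add"
  assumes "(- s + y - s) + x = x + (- s + y + s)"
  shows "- y + (s + x - s) + y = - (s + s) + (s + x - s)"
proof -
  have "- y + (s + x - s) + y = - y + s + (x + (- s + y + s)) - s"
    by (simp add: group_norm del: add_uminus_conv_diff)
  also have "\<dots> = - (s + s) + (s + x - s)"
    by (subst assms[symmetric]) (simp add: group_norm del: add_uminus_conv_diff)
  finally show ?thesis .
qed

section \<open>The generators of U in the braid group and their conjugation formulas\<close>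

fun u_word :: "nat \<Rightarrow> braid_gen \<Rightarrow> braid_gen word" where
  "u_word m (Sigma_gen k) = tau_word m k"
| "u_word m (X_gen r) = w_word m r"
| "u_word m (Z_gen j) = xi_word m j"

lemma u_word_loop: "is_loop a \<Longrightarrow> u_word m a = sigma_down m 1 @ [(a, True)] @ winv (sigma_down m 1)"
  by (cases a) (auto simp: w_word_def xi_word_def)

lemma sigma_down_Suc: "k < m \<Longrightarrow> sigma_down m k = sigma_down m (Suc k) @ sigma k"
  by (simp add: sigma_down_def upt_rec)

lemma sigma_down_self: "sigma_down m m = []"
  by (simp add: sigma_down_def)

lemma braid_gens_iff [simp]:
  "Sigma_gen i \<in> braid_gens m g p \<longleftrightarrow> 1 \<le> i \<and> i \<le> m - 1"
  "X_gen r \<in> braid_gens m g p \<longleftrightarrow> 1 \<le> r \<and> r \<le> 2 * g"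
  "Z_gen j \<in> braid_gens m g p \<longleftrightarrow> 1 \<le> j \<and> j \<le> p - 1"
  by (auto simp: braid_gens_def)

lemma loop_gens: "is_loop a \<Longrightarrow> a \<in> braid_gens m g p \<longleftrightarrow> a \<in> braid_gens m' g p"
  by (cases a) auto

lemma gen_pair_gens: "gen_pair b a \<Longrightarrow> b \<in> braid_gens m g p \<longleftrightarrow> a \<in> braid_gens m' g p"
  by (cases a; cases b) (auto simp: handle_pair_def)

lemma words_sigma_down: "1 \<le> k \<Longrightarrow> sigma_down m k \<in> words (braid_gens m g p)"
  by (auto simp: sigma_down_def words_def braid_gens_def)

lemma words_u_word: "b \<in> braid_gens m g p \<Longrightarrow> u_word m b \<in> words (braid_gens m g p)"
  using words_sigma_down[of 1 m g p]
  by (cases b) (auto simp: tau_word_def w_word_def xi_word_def words_sigma_down)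

text \<open>A faithful copy of the braid group on \<open>m\<close> strands in a type of class
  \<open>group_add\<close>; \<open>cayley\<close> provides one.\<close>

locale braid_embedding =
  fixes \<phi> :: "braid_gen \<Rightarrow> 'h::group_add" and m g p :: nat
  assumes pres_eq_iff: "u \<in> words (braid_gens m g p) \<Longrightarrow> v \<in> words (braid_gens m g p) \<Longrightarrow>
      pres_eq (braid_gens m g p) (braid_rels m g p) u v \<longleftrightarrow> ev \<phi> u = ev \<phi> v"
begin

abbreviation "gens k \<equiv> braid_gens k g p"
abbreviation "s i \<equiv> \<phi> (Sigma_gen i)"
abbreviation "D k \<equiv> ev \<phi> (sigma_down m k)"

text \<open>The actual generators of U_(m-1). Letters outside the alphabet get the value 0, so
  \<open>fev e\<close> maps the free group on all letters onto U_(m-1).\<close>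

definition e :: "'h tuple" where "e b = (if b \<in> gens m then ev \<phi> (u_word m b) else 0)"

lemma rel:
  assumes "(u, v) \<in> braid_rels m g p" "u \<in> words (gens m)" "v \<in> words (gens m)"
  shows "ev \<phi> u = ev \<phi> v"
  using pres_eq_iff[of u v] pres_eq.rel[OF assms] assms by simp

lemma s_braid:
  assumes "1 \<le> i" "i + 1 \<le> m - 1"
  shows "s i + s (Suc i) + s i = s (Suc i) + s i + s (Suc i)"
proof -
  have "ev \<phi> (sigma i @ sigma (i + 1) @ sigma i) = ev \<phi> (sigma (i + 1) @ sigma i @ sigma (i + 1))"
    by (rule rel) (use assms in \<open>auto simp: braid_rels_def\<close>)
  then show ?thesis by (simp add: add.assoc)
qed

lemma s_commute:
  assumes "1 \<le> i" "i \<le> m - 1" "1 \<le> j" "j \<le> m - 1" "i + 1 < j \<or> j + 1 < i"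
  shows "s i + s j = s j + s i"
proof -
  have "ev \<phi> (sigma i @ sigma j) = ev \<phi> (sigma j @ sigma i)"
    by (rule rel) (use assms in \<open>auto simp: braid_rels_def\<close>)
  then show ?thesis by simp
qed

lemma loop_s_commute:
  assumes "is_loop a" "a \<in> gens m" "1 < i" "i \<le> m - 1"
  shows "\<phi> a + s i = s i + \<phi> a"
proof -
  have "ev \<phi> ([(a, True)] @ sigma i) = ev \<phi> (sigma i @ [(a, True)])"
    by (rule rel) (use assms in \<open>cases a; auto simp: braid_rels_def\<close>)+
  then show ?thesis by simp
qed

lemma loop_same:
  assumes "is_loop a" "a \<in> gens m" "2 \<le> m"
  shows "(- s 1 + \<phi> a - s 1) + \<phi> a = \<phi> a + (- s 1 + \<phi> a - s 1)"
proof -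
  have "ev \<phi> ((sigma_inv 1 @ [(a, True)] @ sigma_inv 1) @ [(a, True)]) =
      ev \<phi> ([(a, True)] @ (sigma_inv 1 @ [(a, True)] @ sigma_inv 1))"
    by (rule rel) (use assms in \<open>cases a; auto simp: braid_rels_def\<close>)+
  then show ?thesis by (simp add: group_norm del: add_uminus_conv_diff)
qed

lemma loop_less:
  assumes "gen_less b a" "\<not> gen_pair b a" "b \<in> gens m" "a \<in> gens m" "2 \<le> m"
  shows "(- s 1 + \<phi> b + s 1) + \<phi> a = \<phi> a + (- s 1 + \<phi> b + s 1)"
proof -
  have "ev \<phi> ((sigma_inv 1 @ [(b, True)] @ sigma 1) @ [(a, True)]) =
      ev \<phi> ([(a, True)] @ (sigma_inv 1 @ [(b, True)] @ sigma 1))"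
    by (rule rel) (use assms in \<open>cases a; cases b; auto simp: braid_rels_def\<close>)+
  then show ?thesis by (simp add: group_norm del: add_uminus_conv_diff)
qed

lemma loop_pair:
  assumes "gen_pair b a" "a \<in> gens m" "2 \<le> m"
  shows "(- s 1 + \<phi> b - s 1) + \<phi> a = \<phi> a + (- s 1 + \<phi> b + s 1)"
proof -
  obtain k where k: "b = X_gen (2 * k - 1)" "a = X_gen (2 * k)" "1 \<le> k"
    using assms(1) by (cases a; cases b) (auto simp: handle_pair_def)
  have "ev \<phi> ((sigma_inv 1 @ xgen (2 * k - 1) @ sigma_inv 1) @ xgen (2 * k)) =
      ev \<phi> (xgen (2 * k) @ (sigma_inv 1 @ xgen (2 * k - 1) @ sigma 1))"
    by (rule rel) (use assms k in \<open>auto simp: braid_rels_def\<close>)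
  then show ?thesis by (simp add: k group_norm del: add_uminus_conv_diff)
qed

lemma D_Suc: "k < m \<Longrightarrow> D k = D (Suc k) + s k"
  by (simp add: sigma_down_Suc)

lemma D_self [simp]: "D m = 0"
  by (simp add: sigma_down_self)

lemma s_D_commute: 
  assumes "1 \<le> i" "i + 1 < k" "k \<le> m"
  shows "s i + D k = D k + s i"
  using assms(3,2)
proof (induction k rule: inc_induct)
  case (step k)
  have "s i + D k = (s i + D (Suc k)) + s k" using step.hyps by (simp only: D_Suc add.assoc)
  also have "s i + D (Suc k) = D (Suc k) + s i" using step by simp
  also have "\<dots> + s k = D k + s i" using step assms(1) s_commute[of i k] by (simp add: D_Suc add.assoc)
  finally show ?case .
qed simp

text \<open>Sliding through \<sigma>_(m-1) ... \<sigma>_k raises the index by one: the braid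
  relation does this at \<open>k = i\<close>, and the remaining letters commute.\<close>

lemma s_D_shift: 
  assumes "1 \<le> k" "k \<le> i" "i + 1 < m"
  shows "s i + D k = D k + s (Suc i)"
  using assms(2,1)
proof (induction k rule: inc_induct)
  case base
  have "s i + D i = (s i + D (Suc (Suc i))) + s (Suc i) + s i"
    using assms by (simp add: D_Suc add.assoc)
  also have "\<dots> = D (Suc (Suc i)) + (s i + s (Suc i) + s i)"
    using assms s_D_commute[of i "Suc (Suc i)"] by (simp add: add.assoc)
  also have "\<dots> = D i + s (Suc i)"
    using assms s_braid[of i] by (simp add: D_Suc add.assoc)
  finally show ?case .
next
  case (step k)
  have "s i + D k = (s i + D (Suc k)) + s k" using step.hyps assms by (simp only: D_Suc[of k] add.assoc)
  also have "s i + D (Suc k) = D (Suc k) + s (Suc i)" using step by simp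
  also have "\<dots> + s k = D k + s (Suc i)"
    using step assms s_commute[of "Suc i" k] by (simp add: D_Suc add.assoc)
  finally show ?case .
qed

lemma loop_D_commute: 
  assumes "is_loop a" "a \<in> gens m" "2 \<le> k" "k \<le> m"
  shows "\<phi> a + D k = D k + \<phi> a"
  using assms(4,3)
proof (induction k rule: inc_induct)
  case (step k)
  have "\<phi> a + D k = (\<phi> a + D (Suc k)) + s k" using step.hyps by (simp only: D_Suc add.assoc)
  also have "\<phi> a + D (Suc k) = D (Suc k) + \<phi> a" using step by simp
  also have "\<dots> + s k = D k + \<phi> a" using step assms loop_s_commute[of a k] by (simp add: D_Suc add.assoc)
  finally show ?case .
qed simp

lemma e_sigma: "1 \<le> k \<Longrightarrow> k < m \<Longrightarrow> e (Sigma_gen k) = D (Suc k) + (s k + s k) - D (Suc k)"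
  by (auto simp: e_def tau_word_def group_norm simp del: add_uminus_conv_diff)

lemma e_loop: "is_loop a \<Longrightarrow> a \<in> gens m \<Longrightarrow> 2 \<le> m \<Longrightarrow> e a = D 2 + (s 1 + \<phi> a - s 1) - D 2"
  using D_Suc[of 1]
  by (simp add: e_def u_word_loop group_norm numeral_2_eq_2 del: add_uminus_conv_diff)

lemma e_outside: "b \<notin> gens m \<Longrightarrow> e b = 0"
  by (simp add: e_def)

text \<open>Strips the outer conjugation by \<open>d\<close> once it is known how \<open>c\<close>
  slides through \<open>d\<close>.\<close>

lemma conj_shift:
  fixes c c' d x :: 'h
  assumes "c + d = d + c'"
  shows "- c + (d + x - d) + c = d + (- c' + x + c') - d"
proof -
  have *: "- c + d = d - c'"
  proof -
    have "- c + d = - c + (d + c') - c'" by (simp add: group_norm del: add_uminus_conv_diff)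
    also have "\<dots> = d - c'" by (simp flip: assms add: group_norm del: add_uminus_conv_diff)
    finally show ?thesis .
  qed
  have "- c + (d + x - d) + c = (- c + d) + x - (- c + d)"
    by (simp add: group_norm del: add_uminus_conv_diff)
  also have "\<dots> = d + (- c' + x + c') - d"
    by (simp add: * group_norm del: add_uminus_conv_diff)
  finally show ?thesis .
qed

lemma conj_fixed:
  fixes c x :: 'h
  assumes "c + x = x + c"
  shows "- c + x + c = x" "- c + (x + x) + c = x + x"
proof -
  show *: "- c + x + c = x" using assms by (simp add: add.assoc flip: assms)
  have "- c + (x + x) + c = (- c + x + c) + (- c + x + c)"
    by (simp add: group_norm del: add_uminus_conv_diff)
  then show "- c + (x + x) + c = x + x" by (simp only: *)
qed

text \<open>The loop formulas of the action agree with true conjugation on U. Loops commute with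
  \<open>D 2\<close>, so \<open>conj_shift\<close> reduces the nontrivial cases to the two-strand
  identities.\<close>

lemma conj_e_loop:
  assumes a: "is_loop a" "a \<in> gens m" and m: "2 \<le> m"
  shows "loop_act a e b = - \<phi> a + e b + \<phi> a"
proof -
  let ?y = "\<phi> a" and ?s = "s 1" and ?D = "D 2"
  have e1: "e (Sigma_gen 1) = ?D + (?s + ?s) - ?D"
    using e_sigma[of 1] m by (simp add: numeral_2_eq_2)
  have eD: "e c = ?D + (?s + \<phi> c - ?s) - ?D" if "is_loop c" "c \<in> gens m" for c
    using that m e_loop by blast
  have cD: "- ?y + (?D + x - ?D) + ?y = ?D + (- ?y + x + ?y) - ?D" for x
    by (rule conj_shift) (use loop_D_commute a m in simp)
  have same: "(- ?s + ?y - ?s) + ?y = ?y + (- ?s + ?y - ?s)"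
    using loop_same a m by blast
  show ?thesis
  proof (cases b rule: gen_cases)
    case (1 i)
    consider "i = 1" | "1 < i" "i < m" | "i \<noteq> 1" "Sigma_gen i \<notin> gens m"
      by force
    then show ?thesis
    proof cases
      case 1
      show ?thesis
        unfolding \<open>b = Sigma_gen i\<close> 1 loop_act_simps(1)[OF a(1)] e1 cD conj_square[OF same] eD[OF a]
        by (simp add: group_norm del: add_uminus_conv_diff)
    next
      case 2
      have "- ?y + e b + ?y = D (Suc i) + (- ?y + (s i + s i) + ?y) - D (Suc i)"
        unfolding \<open>b = Sigma_gen i\<close> using 2 a m
        by (subst e_sigma) (auto intro!: conj_shift loop_D_commute)
      also have "- ?y + (s i + s i) + ?y = s i + s i"
        by (rule conj_fixed(2)) (use loop_s_commute[of a i] 2 a in simp)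
      finally show ?thesis
        using 2 \<open>b = Sigma_gen i\<close> a by (simp add: loop_act_simps e_sigma)
    next
      case 3
      then show ?thesis
        using \<open>b = Sigma_gen i\<close> a by (simp add: loop_act_simps e_outside)
    qed
  next
    case 2
    show ?thesis
    proof (cases "b \<in> gens m")
      case False
      \<comment> \<open>A pair lies inside the alphabet or outside it as a whole, so the entry 0 at
        \<open>b\<close> is at most conjugated and stays 0.\<close>
      then have "b \<noteq> a" "\<not> gen_pair b a" "\<not> gen_pair a b"
        using a gen_pair_gens by blast+
      then show ?thesis
        using 2 False a by (auto simp: loop_act_def Let_def e_outside)
    next
      case True
      note eb = eD[OF 2 True]
      consider "b = a" | "gen_pair b a" | "gen_less b a" "\<not> gen_pair b a"
        | "gen_pair a b" | "gen_less a b" "\<not> gen_pair a b"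
        using gen_less_linear[of a b] a 2 by blast
      then show ?thesis
      proof cases
        case 1
        show ?thesis
          unfolding 1 loop_act_simps(4)[OF a(1)] e1 eD[OF a] cD conj_self[OF same]
          by (simp add: group_norm del: add_uminus_conv_diff)
      next
        case 2
        show ?thesis
          unfolding loop_act_simps(5)[OF 2] e1 eD[OF a] eb cD conj_pair_less[OF same loop_pair[OF 2 a(2) m]]
          by (simp add: group_norm del: add_uminus_conv_diff)
      next
        case 3
        show ?thesis
          unfolding loop_act_simps(6)[OF 3] e1 eD[OF a] eb cD conj_less[OF same loop_less[OF 3 True a(2) m]]
          by (simp add: group_norm del: add_uminus_conv_diff)
      next
        case 4
        show ?thesis
          unfolding loop_act_simps(7)[OF 4] e1 eD[OF a] eb cD conj_pair_greater[OF loop_pair[OF 4 True m]]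
          by (simp add: group_norm del: add_uminus_conv_diff)
      next
        case 5
        show ?thesis
          unfolding loop_act_simps(8)[OF 5] e1 eD[OF a] eb cD conj_greater[OF loop_less[OF 5 a(2) True m]]
          by (simp add: group_norm del: add_uminus_conv_diff)
      qed
    qed
  qed
qed

end

lemma braid_conj:
  fixes a b :: "'h::group_add"
  assumes "a + b + a = b + a + b"
  shows "- a + (b + b) + a = b + (a + a) - b"
proof -
  have "(b + b) + a + b = b + (a + b + a)"
    by (subst assms) (simp add: add.assoc)
  also have "\<dots> = (a + b + a) + a"
    by (subst (2) assms) (simp add: add.assoc)
  finally have "- a + (b + b) + a + b = b + (a + a)"
    by (simp add: add.assoc)
  then show ?thesis by (simp add: eq_diff_eq)
qed

text \<open>The braid relation is symmetric, so \<open>braid_conj\<close> applies also with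
  \<open>a\<close> and \<open>b\<close> exchanged.\<close>

lemma braid_conj':
  fixes a b :: "'h::group_add"
  assumes "a + b + a = b + a + b"
  shows "- a + (b + (a + a) - b) + a = (b + (a + a) - b) + (b + b) - (b + (a + a) - b)"
proof -
  have "(b + (a + a) - b) + (b + b) - (b + (a + a) - b) =
      (- a + (b + b) + a) + (b + b) - (- a + (b + b) + a)"
    by (simp only: braid_conj[OF assms])
  also have "\<dots> = - a + (b + b) + (a + (b + b) - a) - (b + b) + a"
    by (simp add: group_norm del: add_uminus_conv_diff)
  also have "\<dots> = - a + (b + b) + (- b + (a + a) + b) - (b + b) + a"
    by (simp only: braid_conj[OF assms[symmetric]])
  also have "\<dots> = - a + (b + (a + a) - b) + a"
    by (simp add: group_norm del: add_uminus_conv_diff)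
  finally show ?thesis by simp
qed

lemma ev_cong: "(\<And>b. b \<in> A \<Longrightarrow> f b = f' b) \<Longrightarrow> w \<in> words A \<Longrightarrow> ev f w = ev f' w"
  by (induction w) auto

context braid_embedding
begin

text \<open>Since \<open>s k\<close> commutes with its square, \<open>D k\<close> may replace
  \<open>D (Suc k)\<close>; this form suits \<open>s_D_shift\<close>.\<close>

lemma e_sigma': "1 \<le> k \<Longrightarrow> k < m \<Longrightarrow> e (Sigma_gen k) = D k + (s k + s k) - D k"
  by (simp add: e_sigma D_Suc group_norm del: add_uminus_conv_diff)

lemma e_loop': "is_loop a \<Longrightarrow> a \<in> gens m \<Longrightarrow> e a = D 1 + \<phi> a - D 1"
  by (simp add: e_def u_word_loop group_norm del: add_uminus_conv_diff)

lemma conj_e_sigma: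
  assumes i: "1 \<le> i" "Suc i < m"
  shows "sig_act i e b = - s i + e b + s i"
proof (cases b rule: gen_cases)
  case (1 k)
  define d where "d = D (Suc (Suc i))"
  have cd: "- s i + (d + x - d) + s i = d + (- s i + x + s i) - d" for x
    unfolding d_def by (rule conj_shift) (use s_D_commute[of i "Suc (Suc i)"] i in simp)
  have e1: "e (Sigma_gen i) = d + (s (Suc i) + (s i + s i) - s (Suc i)) - d"
    using i by (simp add: d_def e_sigma D_Suc[of "Suc i"] group_norm del: add_uminus_conv_diff)
  have e2: "e (Sigma_gen (Suc i)) = d + (s (Suc i) + s (Suc i)) - d"
    using i by (simp add: d_def e_sigma)
  have br: "s i + s (Suc i) + s i = s (Suc i) + s i + s (Suc i)"
    using i s_braid[of i] by simp
  consider "k = i" | "k = Suc i" | "1 \<le> k" "k < i" | "Suc i < k" "k < m" 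
    | "Sigma_gen k \<notin> gens m" "k \<noteq> i" "k \<noteq> Suc i"
    by fastforce
  then show ?thesis
  proof cases
    case 1
    show ?thesis
      unfolding \<open>b = _\<close> 1 sig_act_simps(1) e1 e2 cd braid_conj'[OF br]
      by (simp add: group_norm del: add_uminus_conv_diff)
  next
    case 2
    show ?thesis
      unfolding \<open>b = _\<close> 2 sig_act_simps(2) e1 e2 cd braid_conj[OF br] ..
  next
    case 3
    have "- s i + e b + s i = D k + (- s (Suc i) + (s k + s k) + s (Suc i)) - D k"
      unfolding \<open>b = _\<close> using 3 i
      by (subst e_sigma') (auto intro!: conj_shift s_D_shift)
    also have "- s (Suc i) + (s k + s k) + s (Suc i) = s k + s k"
      by (rule conj_fixed(2)) (use s_commute[of "Suc i" k] 3 i in simp)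
    finally show ?thesis
      using 3 i \<open>b = _\<close> by (simp add: sig_act_simps e_sigma')
  next
    case 4
    have "- s i + e b + s i = D (Suc k) + (- s i + (s k + s k) + s i) - D (Suc k)"
      unfolding \<open>b = _\<close> using 4 i
      by (subst e_sigma) (auto intro!: conj_shift s_D_commute)
    also have "- s i + (s k + s k) + s i = s k + s k"
      by (rule conj_fixed(2)) (use s_commute[of i k] 4 i in simp)
    finally show ?thesis
      using 4 i \<open>b = _\<close> by (simp add: sig_act_simps e_sigma)
  next
    case 5
    then show ?thesis
      using \<open>b = _\<close> by (simp add: sig_act_simps e_outside)
  qed
next
  case 2
  show ?thesis
  proof (cases "b \<in> gens m")
    case True
    have "- s i + e b + s i = D 1 + (- s (Suc i) + \<phi> b + s (Suc i)) - D 1"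
      unfolding e_loop'[OF 2 True] by (rule conj_shift, rule s_D_shift) (use i in auto)
    also have "- s (Suc i) + \<phi> b + s (Suc i) = \<phi> b"
      by (rule conj_fixed(1)) (use loop_s_commute[OF 2 True, of "Suc i"] i in simp)
    finally show ?thesis using 2 True by (simp add: sig_act_simps e_loop')
  qed (use 2 in \<open>simp add: sig_act_simps e_outside\<close>)
qed

lemma act_e:
  assumes "a \<in> gens (m - 1)" "2 \<le> m"
  shows "ap (act a) e = (\<lambda>b. - \<phi> a + e b + \<phi> a)"
proof (cases a rule: gen_cases)
  case (1 i)
  then show ?thesis using assms conj_e_sigma[of i] by (auto simp: fun_eq_iff)
next
  case 2
  then show ?thesis
    using assms conj_e_loop[of a] loop_gens[of a m g p "m - 1"] by (auto simp: fun_eq_iff ap_act_loop)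
qed

text \<open>A letter acts after the rest of the word, but by naturality its conjugation ends up
  inside that of the rest. Thus the left action on tuples matches conjugation on the right.\<close>

lemma act_word_e:
  assumes "w \<in> words (gens (m - 1))" "2 \<le> m"
  shows "ap (ev act w) e = (\<lambda>b. - ev \<phi> w + e b + ev \<phi> w)"
  using assms(1)
proof (induction w)
  case (Cons l w)
  obtain a t where l: "l = (a, t)" by fastforce
  have a: "a \<in> gens (m - 1)" and w: "w \<in> words (gens (m - 1))" using Cons l by auto
  let ?c = "\<lambda>z x. - z + x + (z::'h)"
  have pos: "ap (act a) e = ?c (\<phi> a) \<circ> e"
    using act_e[OF a assms(2)] by (simp add: comp_def)
  have "ap (- act a) e = ap (- act a) (?c (- \<phi> a) \<circ> (?c (\<phi> a) \<circ> e))"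
    by (simp add: comp_def group_norm del: add_uminus_conv_diff)
  also have "\<dots> = ?c (- \<phi> a) \<circ> e"
    using act_word_natural[OF hom_add_conj, of "[(a, False)]" "- \<phi> a" "?c (\<phi> a) \<circ> e"] pos[symmetric]
    by simp
  finally have neg: "ap (- act a) e = ?c (- \<phi> a) \<circ> e" .
  have l1: "ap (ev act [l]) e = ?c (ev \<phi> [l]) \<circ> e"
    by (cases t) (simp_all only: l ev.simps if_True if_False pos neg add_0_right)
  have "ap (ev act (l # w)) e = ap (ev act [l]) (?c (ev \<phi> w) \<circ> e)"
    using Cons.IH[OF w] by (simp add: l comp_def)
  also have "\<dots> = ?c (ev \<phi> w) \<circ> (?c (ev \<phi> [l]) \<circ> e)"
    by (simp only: act_word_natural[OF hom_add_conj] l1)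
  also have "\<dots> = (\<lambda>b. - ev \<phi> (l # w) + e b + ev \<phi> (l # w))"
    by (simp add: l comp_def group_norm del: add_uminus_conv_diff)
  finally show ?case .
qed simp

text \<open>Extends the formulas from generators to all of U; in particular braids on
  \<open>m - 1\<close> strands normalise U.\<close>

lemma conj_fev_e:
  assumes "w \<in> words (gens (m - 1))" "2 \<le> m"
  shows "- ev \<phi> w + fev e x + ev \<phi> w = fev e (fev (ap (ev act w) fg_gen) x)"
proof -
  have "fev e (fev (ap (ev act w) fg_gen) x) = fev (fev e \<circ> ap (ev act w) fg_gen) x"
    by (rule fev_comp[OF fev_hom])
  also have "fev e \<circ> ap (ev act w) fg_gen = ap (ev act w) (fev e \<circ> fg_gen)"
    by (simp only: act_word_natural[OF fev_hom])
  also have "fev e \<circ> fg_gen = e" by (simp add: fun_eq_iff)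
  also have "ap (ev act w) e = (\<lambda>x. - ev \<phi> w + x + ev \<phi> w) \<circ> e"
    using act_word_e[OF assms] by (simp add: comp_def)
  also have "fev \<dots> x = - ev \<phi> w + fev e x + ev \<phi> w"
    by (rule fev_comp[OF hom_add_conj, symmetric])
  finally show ?thesis ..
qed

section \<open>Decomposition into a push, a braid on fewer strands and a coset
  representative\<close>

lemma shift_minus:
  fixes c c' d :: 'h
  assumes "c + d = d + c'"
  shows "d - c' = - c + d"
proof -
  have "d - c' = - c + (c + d) - c'" by (simp add: group_norm del: add_uminus_conv_diff)
  also have "\<dots> = - c + d" by (simp add: assms group_norm del: add_uminus_conv_diff)
  finally show ?thesis .
qed

text \<open>The union of the sets U B_(m-1) \<open>D k\<close> is closed under right multiplication
  by letters: a letter slides through \<open>D k\<close>, or lengthens or shortens it, in some cases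
  splitting off a generator of U or its inverse.\<close>

lemma D_step:
  assumes a: "a \<in> gens m" and k: "1 \<le> k" "k \<le> m"
  shows "\<exists>x \<delta> j. \<delta> \<in> words (gens (m - 1)) \<and> 1 \<le> j \<and> j \<le> m \<and>
    D k + ev \<phi> [(a, t)] = fev e x + ev \<phi> \<delta> + D j"
proof (cases a rule: gen_cases)
  case (1 i)
  then have i: "1 \<le> i" "i < m" using a by auto
  have D: "D i = D (Suc i) + s i" using i D_Suc by blast
  consider "Suc i < k" | "k = Suc i" | "k = i" | "k < i" by linarith
  then show ?thesis
  proof cases
    case 1
    then have c: "s i + D k = D k + s i" using s_D_commute i k by simp
    show ?thesis
      using shift_minus[OF c] c 1 i k \<open>a = _\<close>
      by (intro exI[of _ 0] exI[of _ "[(a, t)]"] exI[of _ k]) auto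
  next
    case 2
    have neg: "D (Suc i) - s i = - e a + D i"
      using i \<open>a = _\<close> by (simp add: e_sigma D group_norm del: add_uminus_conv_diff)
    show ?thesis
    proof (cases t)
      case True
      then show ?thesis using 2 i D \<open>a = _\<close>
        by (intro exI[of _ 0] exI[of _ "[]"] exI[of _ i]) auto
    next
      case False
      then show ?thesis using 2 i neg \<open>a = _\<close>
        by (intro exI[of _ "- fg_gen a"] exI[of _ "[]"] exI[of _ i]) auto
    qed
  next
    case 3
    have pos: "D i + s i = e a + D (Suc i)"
      using i \<open>a = _\<close> by (simp add: e_sigma D group_norm del: add_uminus_conv_diff)
    show ?thesis
    proof (cases t)
      case True
      then show ?thesis using 3 i pos \<open>a = _\<close>
        by (intro exI[of _ "fg_gen a"] exI[of _ "[]"] exI[of _ "Suc i"]) auto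
    next
      case False
      then show ?thesis using 3 i D \<open>a = _\<close>
        by (intro exI[of _ 0] exI[of _ "[]"] exI[of _ "Suc i"]) auto
    qed
  next
    case 4
    then obtain j where j: "i = Suc j" "k \<le> j" by (cases i) auto
    have c: "s j + D k = D k + s i" using s_D_shift[of k j] i k j by simp
    show ?thesis
      using shift_minus[OF c] c j i k \<open>a = _\<close>
      by (intro exI[of _ 0] exI[of _ "[(Sigma_gen j, t)]"] exI[of _ k]) auto
  qed
next
  case 2
  show ?thesis
  proof (cases "k = 1")
    case True
    have "D 1 + \<phi> a = e a + D 1" "D 1 - \<phi> a = - e a + D 1"
      using a 2 by (simp_all add: e_loop' group_norm del: add_uminus_conv_diff)
    then show ?thesis
      using True k
      by (intro exI[of _ "if t then fg_gen a else - fg_gen a"] exI[of _ "[]"] exI[of _ 1]) auto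
  next
    case False
    then have c: "\<phi> a + D k = D k + \<phi> a" using loop_D_commute a 2 k by simp
    show ?thesis
      using shift_minus[OF c] c k a 2 loop_gens[OF 2, of m g p "m - 1"]
      by (intro exI[of _ 0] exI[of _ "[(a, t)]"] exI[of _ k]) auto
  qed
qed

lemma decompose:
  assumes "w \<in> words (gens m)" "2 \<le> m"
  shows "\<exists>x \<gamma> k. \<gamma> \<in> words (gens (m - 1)) \<and> 1 \<le> k \<and> k \<le> m \<and> ev \<phi> w = fev e x + ev \<phi> \<gamma> + D k"
  using assms(1)
proof (induction w rule: rev_induct)
  case Nil
  show ?case using assms(2) by (intro exI[of _ 0] exI[of _ "[]"] exI[of _ m]) auto
next
  case (snoc l w)
  obtain a t where l: "l = (a, t)" by fastforce
  obtain x \<gamma> k where 1: "\<gamma> \<in> words (gens (m - 1))" "1 \<le> k" "k \<le> m"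
      "ev \<phi> w = fev e x + ev \<phi> \<gamma> + D k"
    using snoc by auto
  obtain y \<delta> j where 2: "\<delta> \<in> words (gens (m - 1))" "1 \<le> j" "j \<le> m"
      "D k + ev \<phi> [(a, t)] = fev e y + ev \<phi> \<delta> + D j"
    using D_step[of a k t] snoc.prems l 1 by auto
  \<comment> \<open>Moves the new push \<open>y\<close> to the left of \<open>\<gamma>\<close>,
    which acts on it by conjugation.\<close>
  define z where "z = fev (ap (ev act (winv \<gamma>)) fg_gen) y"
  have z: "fev e z = ev \<phi> \<gamma> + fev e y - ev \<phi> \<gamma>"
    using conj_fev_e[of "winv \<gamma>" y] 1 assms(2) by (simp add: z_def)
  have "ev \<phi> (w @ [l]) = fev e x + ev \<phi> \<gamma> + (D k + ev \<phi> [(a, t)])"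
    by (simp add: 1 l add.assoc)
  also have "\<dots> = fev e (x + z) + ev \<phi> (\<gamma> @ \<delta>) + D j"
    unfolding 2 by (simp add: z group_norm del: add_uminus_conv_diff)
  finally show ?case using 1 2 by (intro exI[of _ "x + z"] exI[of _ "\<gamma> @ \<delta>"] exI[of _ j]) auto
qed

end

section \<open>Pushing the last point\<close>

text \<open>The representative \<open>sigma_down m k\<close> brings point \<open>k\<close> to the
  last place, so \<open>k\<close> can be read off from the last entry.\<close>

lemma sigma_down_act:
  assumes "k \<le> m"
  shows "ap (ev act (sigma_down m k)) f (Sigma_gen m) = f (Sigma_gen k)"
    and "j < k \<Longrightarrow> ap (ev act (sigma_down m k)) f (Sigma_gen j) = f (Sigma_gen j)"
    and "is_loop c \<Longrightarrow> ap (ev act (sigma_down m k)) f c = f c"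
proof -
  have "ap (ev act (sigma_down m k)) f (Sigma_gen m) = f (Sigma_gen k) \<and>
    (\<forall>j<k. ap (ev act (sigma_down m k)) f (Sigma_gen j) = f (Sigma_gen j)) \<and>
    (\<forall>c. is_loop c \<longrightarrow> ap (ev act (sigma_down m k)) f c = f c)"
    using assms
  proof (induction k arbitrary: f rule: inc_induct)
    case (step k)
    then show ?case
      by (simp add: sigma_down_Suc sig_act_simps step.IH less_SucI)
  qed (simp add: sigma_down_self)
  then show "ap (ev act (sigma_down m k)) f (Sigma_gen m) = f (Sigma_gen k)"
    "j < k \<Longrightarrow> ap (ev act (sigma_down m k)) f (Sigma_gen j) = f (Sigma_gen j)"
    "is_loop c \<Longrightarrow> ap (ev act (sigma_down m k)) f c = f c"
    by blast+
qed

text \<open>Point pushing: the loop around the last point is conjugated by the curve along which the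
  point moves. The two alternatives for \<open>c\<close> differ only by a conjugation with that
  loop.\<close>

lemma u_word_act_last:
  fixes f :: "'a::group_add tuple"
  assumes "b \<in> braid_gens m g p" "1 \<le> m"
  defines "t \<equiv> f (Sigma_gen m)"
  shows "\<exists>c. ap (ev act (u_word m b)) f (Sigma_gen m) = c + t - c \<and> (c = f b \<or> c = - t + f b + t)"
proof (cases b rule: gen_cases)
  case (1 k)
  then have k: "1 \<le> k" "Suc k \<le> m" using assms by auto
  let ?D = "ev act (sigma_down m (Suc k)) :: 'a tuple symg"
  define f' where "f' = ap (- ?D) f"
  have f: "f = ap ?D f'" by (simp add: f'_def)
  have "ap (ev act (u_word m b)) f (Sigma_gen m) = sig_act k (sig_act k f') (Sigma_gen (Suc k))"
    using k by (simp add: 1 tau_word_def f'_def sigma_down_act)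
  also have "\<dots> = f' (Sigma_gen k) + f' (Sigma_gen (Suc k)) - f' (Sigma_gen k)"
    by (simp add: sig_act_simps)
  also have "\<dots> = f b + t - f b"
    using k sigma_down_act(1)[of "Suc k" m f'] sigma_down_act(2)[of "Suc k" m k f']
    by (simp add: t_def 1 flip: f)
  finally show ?thesis by blast
next
  case 2
  let ?D = "ev act (sigma_down m (Suc 0)) :: 'a tuple symg"
  define f' where "f' = ap (- ?D) f"
  have f: "f = ap ?D f'" by (simp add: f'_def)
  have t: "f' (Sigma_gen 1) = t" "f' b = f b"
    using sigma_down_act(1)[of 1 m f'] sigma_down_act(3)[of 1 m b f'] assms(2) 2
    by (simp_all add: t_def flip: f)
  have "ap (ev act (u_word m b)) f (Sigma_gen m) = loop_act b f' (Sigma_gen 1)"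
    using 2 assms(2) by (simp add: u_word_loop f'_def sigma_down_act ap_act_loop)
  also have "\<dots> = (- t + f b + t) + t - (- t + f b + t)"
    using 2 t by (simp add: loop_act_simps group_norm del: add_uminus_conv_diff)
  finally show ?thesis by blast
qed

text \<open>Once the last point is filled in, pushing it has no effect: the core of the conjugated
  word fixes a tuple whose relevant \<tau> entry is 0.\<close>

lemma u_word_act_trivial:
  fixes f :: "'a::group_add tuple"
  assumes "b \<in> braid_gens m g p" "1 \<le> m" "f (Sigma_gen m) = 0"
  shows "ap (ev act (u_word m b)) f = f"
proof (cases b rule: gen_cases)
  case (1 k)
  then have k: "1 \<le> k" "Suc k \<le> m" using assms by auto
  let ?D = "ev act (sigma_down m (Suc k)) :: 'a tuple symg"
  define f' where "f' = ap (- ?D) f"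
  have f: "f = ap ?D f'" by (simp add: f'_def)
  have "f' (Sigma_gen (Suc k)) = 0"
    using sigma_down_act(1)[of "Suc k" m f'] k assms(3) by (simp flip: f)
  then have "sig_act k (sig_act k f') = f'"
    by (auto simp: sig_act_def fun_eq_iff)
  then show ?thesis
    using f by (simp add: 1 tau_word_def flip: f'_def)
next
  case 2
  let ?D = "ev act (sigma_down m (Suc 0)) :: 'a tuple symg"
  define f' where "f' = ap (- ?D) f"
  have f: "f = ap ?D f'" by (simp add: f'_def)
  have "f' (Sigma_gen 1) = 0"
    using sigma_down_act(1)[of 1 m f'] assms by (simp flip: f)
  then have "loop_act b f' = f'"
    using 2 by (auto simp: loop_act_def fun_eq_iff Let_def)
  then show ?thesis
    using f 2 by (simp add: u_word_loop ap_act_loop flip: f'_def)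
qed

lemma ev_invariant:
  assumes "\<And>b f. b \<in> A \<Longrightarrow> I (ap (F b) f) = I f" and "w \<in> words A"
  shows "I (ap (ev F w) f) = I f"
  using assms(2)
proof (induction w arbitrary: f)
  case (Cons l w)
  obtain a t where l: "l = (a, t)" by fastforce
  have "I (ap (- F a) f) = I f" for f
    using assms(1)[of a "ap (- F a) f"] Cons.prems l by simp
  then show ?case using Cons l assms(1)[of a] by simp
qed simp

lemma ev_fixes:
  assumes "\<And>b. ap (F b) f = f"
  shows "ap (ev F w) f = f"
proof (induction w)
  case (Cons l w)
  obtain a t where l: "l = (a, t)" by fastforce
  have "ap (- F a) f = f" by (metis assms ap_minus_cancel(1))
  then show ?case using Cons l assms by simp
qed simp

text \<open>The retraction of the free group onto the letters of U_(m-1). It kills \<tau>_m, since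
  \<open>Sigma_gen m\<close> is not in the alphabet.\<close>

definition ret :: "nat \<Rightarrow> nat \<Rightarrow> nat \<Rightarrow> braid_gen fg tuple" where
  "ret m g p b = (if b \<in> braid_gens m g p then fg_gen b else 0)"

definition u_subst :: "nat \<Rightarrow> nat \<Rightarrow> nat \<Rightarrow> braid_gen \<Rightarrow> braid_gen word" where
  "u_subst m g p b = (if b \<in> braid_gens m g p then u_word m b else [])"

fun subst_word :: "('a \<Rightarrow> 'b word) \<Rightarrow> 'a word \<Rightarrow> 'b word" where
  "subst_word h [] = []"
| "subst_word h ((a, t) # w) = (if t then h a else winv (h a)) @ subst_word h w"

lemma ev_subst_word: "ev f (subst_word h w) = ev (\<lambda>a. ev f (h a)) w"
  by (induction h w rule: subst_word.induct) auto

lemma words_subst_word: "(\<And>a. h a \<in> words A) \<Longrightarrow> subst_word h w \<in> words A"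
  by (induction h w rule: subst_word.induct) auto

abbreviation u_act :: "nat \<Rightarrow> nat \<Rightarrow> nat \<Rightarrow> braid_gen \<Rightarrow> 'h::group_add tuple symg" where
  "u_act m g p b \<equiv> ev act (u_subst m g p b)"

lemma u_act_trivial:
  assumes "1 \<le> m" "f (Sigma_gen m) = 0"
  shows "ap (ev (u_act m g p) w) f = f"
  by (rule ev_fixes) (use assms u_word_act_trivial[of _ m g p f] in \<open>auto simp: u_subst_def\<close>)

text \<open>A push only conjugates the last entry, which is invisible in an abelian group.\<close>

lemma u_act_abelian:
  fixes f :: "int tuple"
  assumes "1 \<le> m"
  shows "ap (ev (u_act m g p) w) f (Sigma_gen m) = f (Sigma_gen m)"
proof (rule ev_invariant[of UNIV "\<lambda>f. f (Sigma_gen m)"])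
  fix b and f :: "int tuple"
  show "ap (u_act m g p b) f (Sigma_gen m) = f (Sigma_gen m)"
    using u_word_act_last[of b m g p f] assms by (auto simp: u_subst_def)
qed simp

text \<open>Braids on \<open>m - 1\<close> strands use \<sigma>_i with \<open>i \<le> m - 2\<close>
  and change \<tau> entries only up to index \<open>m - 1\<close>.\<close>

lemma act_last_invariant:
  fixes f :: "'a::group_add tuple"
  assumes "w \<in> words (braid_gens (m - 1) g p)" "2 \<le> m"
  shows "ap (ev act w) f (Sigma_gen m) = f (Sigma_gen m)"
proof (rule ev_invariant[OF _ assms(1), of "\<lambda>f. f (Sigma_gen m)"])
  fix b and f :: "'a tuple"
  assume b: "b \<in> braid_gens (m - 1) g p"
  show "ap (act b) f (Sigma_gen m) = f (Sigma_gen m)"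
  proof (cases b rule: gen_cases)
    case (1 i)
    then show ?thesis using b assms(2) by (auto simp: sig_act_simps)
  qed (use assms(2) in \<open>simp add: ap_act_loop loop_act_simps\<close>)
qed

text \<open>The wreath product \<open>\<int> \<wr> G\<close>. Its point mass at \<open>h\<close> serves as the image of the loop around the
  last point; conjugation by an element over \<open>b\<close> moves the mass to \<open>b + h\<close>, so that a push of the
  last point along a loop is recorded by the position of the mass.\<close>

datatype 'g wr = Wr "'g \<Rightarrow> int" (wsnd: 'g)

instantiation wr :: (group_add) group_add
begin
fun plus_wr :: "'a wr \<Rightarrow> 'a wr \<Rightarrow> 'a wr" where
  "Wr P a + Wr Q b = Wr (\<lambda>x. P x + Q (- a + x)) (a + b)"
definition "0 = Wr (\<lambda>_. 0) 0"
fun uminus_wr :: "'a wr \<Rightarrow> 'a wr" where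
  "- Wr P a = Wr (\<lambda>x. - P (a + x)) (- a)"
definition "minus_wr a b = a + - (b :: 'a wr)"
instance
proof
  fix a b c :: "'a wr"
  show "a + b + c = a + (b + c)"
    by (cases a; cases b; cases c) (simp add: group_norm del: add_uminus_conv_diff)
  show "0 + a = a" "a + 0 = a" "- a + a = 0"
    by (cases a; simp add: zero_wr_def)+
  show "a + - b = a - b" by (simp add: minus_wr_def)
qed
end

definition mass :: "'g::group_add \<Rightarrow> 'g wr" where "mass h = Wr (\<lambda>x. if x = h then 1 else 0) 0"

lemma wsnd_hom: "hom_add wsnd"
  unfolding hom_add_def
proof (intro allI)
  fix a b :: "'a wr"
  show "wsnd (a + b) = wsnd a + wsnd b" by (cases a; cases b) simp
qed

lemmas wsnd_simps [simp] = hom_add_simps[OF wsnd_hom]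

lemma wsnd_mass [simp]: "wsnd (mass h) = 0"
  by (simp add: mass_def)

lemma mass_inject [simp]: "mass h = mass k \<longleftrightarrow> h = k"
  by (auto simp: mass_def fun_eq_iff split: if_splits)

lemma conj_mass: "c + mass h - c = mass (wsnd c + h)"
proof -
  have "- b + x = h \<longleftrightarrow> x = b + h" for b x :: 'a
    by (metis add_minus_cancel minus_add_cancel)
  then show ?thesis
    by (cases c) (simp add: mass_def diff_conv_add_uminus fun_eq_iff del: add_uminus_conv_diff)
qed

text \<open>Modulo the mass the pushes act trivially, so the projection stays
  \<open>ret m g p\<close> throughout. Each letter therefore conjugates the mass by an element over
  that same letter, and the positions add up to the word.\<close>

lemma u_act_mass:
  fixes f :: "braid_gen fg wr tuple"
  assumes "1 \<le> m" "wsnd \<circ> f = ret m g p" "f (Sigma_gen m) = mass h"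
  shows "wsnd \<circ> ap (ev (u_act m g p) w) f = ret m g p \<and>
    ap (ev (u_act m g p) w) f (Sigma_gen m) = mass (ev (ret m g p) w + h)"
  using assms(2,3)
proof (induction w)
  case (Cons l w)
  obtain b t where l: "l = (b, t)" by fastforce
  let ?f = "ap (ev (u_act m g p) w) f"
  let ?U = "u_act m g p b :: braid_gen fg wr tuple symg" and ?h = "ev (ret m g p) w + h"
  have IH: "wsnd \<circ> ?f = ret m g p" "?f (Sigma_gen m) = mass ?h"
    using Cons.IH[OF Cons.prems] by blast+
  have last0: "ret m g p (Sigma_gen m) = 0" using assms(1) by (auto simp: ret_def)
  have nat: "wsnd \<circ> ap (ev act v) k = ap (ev act v) (wsnd \<circ> k)" for v and k :: "braid_gen fg wr tuple"
    using act_word_natural[OF wsnd_hom] by metis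
  have proj: "wsnd \<circ> ap ?U k = ret m g p" if "wsnd \<circ> k = ret m g p" for k
    using u_act_trivial[of m "ret m g p" g p "[(b, True)]", OF assms(1) last0] by (simp add: nat that)
  have projm: "wsnd \<circ> ap (- ?U) k = ret m g p" if "wsnd \<circ> k = ret m g p" for k
    using u_act_trivial[of m "ret m g p" g p "[(b, False)]", OF assms(1) last0]
      nat[of "winv (u_subst m g p b)" k] by (simp add: that)
  \<comment> \<open>The last entry projects to 0, so both alternatives of
    \<open>u_word_act_last\<close> have the same projection.\<close>
  have last: "\<exists>c. ap ?U k (Sigma_gen m) = c + k (Sigma_gen m) - c \<and> wsnd c = ret m g p b"
    if k: "wsnd \<circ> k = ret m g p" for k
  proof (cases "b \<in> braid_gens m g p")
    case True
    have "wsnd (k b) = ret m g p b" "wsnd (k (Sigma_gen m)) = 0"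
      using k last0 by (auto simp: fun_eq_iff)
    then show ?thesis
      using u_word_act_last[OF True assms(1), of k] True by (auto simp: u_subst_def)
  next
    case False
    then show ?thesis by (intro exI[of _ 0]) (auto simp: u_subst_def ret_def)
  qed
  show ?case
  proof (cases t)
    case True
    obtain c where "ap ?U ?f (Sigma_gen m) = c + ?f (Sigma_gen m) - c" "wsnd c = ret m g p b"
      using last[OF IH(1)] by blast
    then show ?thesis
      using proj[OF IH(1)] True by (simp add: l IH conj_mass add.assoc)
  next
    case False
    \<comment> \<open>For an inverse letter the formula is applied to the preimage tuple and solved
      for its last entry.\<close>
    let ?k = "ap (- ?U) ?f"
    have k: "wsnd \<circ> ?k = ret m g p" by (rule projm[OF IH(1)])
    obtain c where c: "ap ?U ?k (Sigma_gen m) = c + ?k (Sigma_gen m) - c" "wsnd c = ret m g p b"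
      using last[OF k] by blast
    have "?k (Sigma_gen m) = - c + (c + ?k (Sigma_gen m) - c) - - c"
      by (simp add: group_norm del: add_uminus_conv_diff)
    also have "\<dots> = - c + mass ?h - - c"
      using c(1) IH(2) by simp
    also have "\<dots> = mass (- ret m g p b + ?h)"
      by (simp only: conj_mass wsnd_simps c(2))
    finally show ?thesis
      using k False by (simp add: l add.assoc)
  qed
qed simp

section \<open>Braids acting as inner automorphisms\<close>

text \<open>A lift of \<open>ret m g p\<close> to the wreath product, with a point mass in place of
  the killed \<tau>_m.\<close>

definition mass_tuple :: "nat \<Rightarrow> nat \<Rightarrow> nat \<Rightarrow> braid_gen fg wr tuple" where
  "mass_tuple m g p b = (if b = Sigma_gen m then mass 0
    else if b \<in> braid_gens m g p then Wr (\<lambda>_. 0) (fg_gen b) else 0)"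

lemma wsnd_mass_tuple: "1 \<le> m \<Longrightarrow> wsnd \<circ> mass_tuple m g p = ret m g p"
  by (auto simp: mass_tuple_def ret_def fun_eq_iff)

lemma mass_tuple_last [simp]: "mass_tuple m g p (Sigma_gen m) = mass 0"
  by (simp add: mass_tuple_def)

lemma words_u_subst: "subst_word (u_subst m g p) v \<in> words (braid_gens m g p)"
  by (rule words_subst_word) (simp add: u_subst_def words_u_word)

lemma fev_ret: "fev f (ret m g p b) = (if b \<in> braid_gens m g p then f b else 0)"
  by (simp add: ret_def)

context braid_embedding
begin

lemma act_cong:
  assumes "w \<in> words (gens m)" "w' \<in> words (gens m)" "ev \<phi> w = ev \<phi> w'"
  shows "ev act w = ev act w'"
  using assms pres_eq_iff act_pres_eq by blast

lemma ev_e: "ev \<phi> (subst_word (u_subst m g p) v) = ev e v"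
proof -
  have "(\<lambda>b. ev \<phi> (u_subst m g p b)) = e" by (auto simp: e_def u_subst_def)
  then show ?thesis by (simp add: ev_subst_word)
qed

lemma fev_e_ret: "fev e (fev (ret m g p) x) = fev e x"
proof -
  have "fev e \<circ> ret m g p = e" by (auto simp: e_def ret_def fun_eq_iff)
  then show ?thesis by (simp add: fev_comp[OF fev_hom])
qed

text \<open>Freeness of U_(m-1): a relation among its generators acts trivially on
  \<open>mass_tuple m g p\<close>, while the mass is moved to the element of the free group that the
  relation spells.\<close>

lemma fev_e_eq_0_imp:
  assumes "fev e x = 0" "1 \<le> m"
  shows "fev (ret m g p) x = 0"
proof -
  obtain v where v: "x = ev fg_gen v" using ev_fg_gen_surj by metis
  have "ev \<phi> (subst_word (u_subst m g p) v) = ev \<phi> []"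
    using assms(1) by (simp add: ev_e v)
  then have "ev act (subst_word (u_subst m g p) v) = (ev act [] :: braid_gen fg wr tuple symg)"
    by (intro act_cong) (simp_all add: words_u_subst)
  then have "mass_tuple m g p (Sigma_gen m) = mass (ev (ret m g p) v + 0)"
    using u_act_mass[OF assms(2) wsnd_mass_tuple[OF assms(2)] mass_tuple_last, of g p v]
    by (simp add: ev_subst_word)
  then show ?thesis by (simp add: v)
qed

lemma decompose_word:
  assumes "w \<in> words (gens m)" "2 \<le> m"
  obtains v \<gamma> k where "\<gamma> \<in> words (gens (m - 1))" "1 \<le> k" "k \<le> m"
    "ev \<phi> w = ev \<phi> (subst_word (u_subst m g p) v @ \<gamma> @ sigma_down m k)"
proof -
  obtain x \<gamma> k where 1: "\<gamma> \<in> words (gens (m - 1))" "1 \<le> k" "k \<le> m"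
      "ev \<phi> w = fev e x + ev \<phi> \<gamma> + D k"
    using decompose[OF assms] by blast
  obtain v where "x = ev fg_gen v" using ev_fg_gen_surj by metis
  then show thesis
    using that[of \<gamma> k v] 1 by (simp add: ev_e add.assoc)
qed

text \<open>The image \<open>U\<close> of the conjugator is central modulo the mass, so it projects
  to 0 and fixes the mass. But the push moves the mass to \<open>ev (ret m g p) v\<close>, which
  must then vanish.\<close>

lemma inner_push_trivial:
  assumes m: "1 \<le> m" and w: "w \<in> words (gens m)" and push: "ev \<phi> w = ev e v"
    and loops: "a\<^sub>1 \<noteq> a\<^sub>2" "a\<^sub>1 \<in> gens m" "a\<^sub>2 \<in> gens m"
    and inner: "\<And>b. b \<in> gens (m + 1) \<Longrightarrow>
      ap (ev act w) (ret (m + 1) g p) b = - u + ret (m + 1) g p b + u"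
  shows "ev \<phi> w = 0"
proof -
  let ?f = "mass_tuple m g p" and ?A = "ev (u_act m g p) v"
  define U where "U = fev ?f u"
  have gens: "b \<in> gens (m + 1)" if "b \<in> gens m" for b
    using that m by (cases b) auto
  \<comment> \<open>Specialises the free generators of U_m to the mass tuple; the alphabet for
    \<open>m + 1\<close> is needed to include \<tau>_m.\<close>
  have f: "fev ?f \<circ> ret (m + 1) g p = ?f"
    using m gens by (auto simp: fev_ret mass_tuple_def fun_eq_iff)
  have act: "ev act w = (?A :: braid_gen fg wr tuple symg)"
    using act_cong[OF w words_u_subst, unfolded ev_e, OF push] by (simp add: ev_subst_word)
  have A: "ap ?A ?f b = - U + ?f b + U" if b: "b \<in> gens (m + 1)" for b
  proof -
    have "ap ?A ?f b = fev ?f (ap (ev act w) (ret (m + 1) g p) b)"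
      using fun_cong[OF act_word_natural[OF fev_hom, of w ?f "ret (m + 1) g p"], of b]
      by (simp only: act[symmetric] f o_apply)
    also have "\<dots> = - U + (fev ?f \<circ> ret (m + 1) g p) b + U"
      using inner[OF b] by (simp add: U_def)
    finally show ?thesis by (simp only: f)
  qed
  have mass: "wsnd \<circ> ap ?A ?f = ret m g p" "ap ?A ?f (Sigma_gen m) = mass (ev (ret m g p) v + 0)"
    using u_act_mass[OF m wsnd_mass_tuple[OF m] mass_tuple_last, of g p v] by blast+
  have "wsnd U = 0"
  proof (rule fg_centralizer[OF loops(1)])
    have "wsnd U + fg_gen b = fg_gen b + wsnd U" if b: "b \<in> gens m" for b
    proof -
      have "wsnd (?f b) = fg_gen b" "wsnd (ap ?A ?f b) = fg_gen b"
        using wsnd_mass_tuple[OF m, of g p] mass(1) b by (simp_all add: fun_eq_iff ret_def)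
      then have "fg_gen b = - wsnd U + fg_gen b + wsnd U"
        using A[OF gens[OF b]] by simp
      then have "wsnd U + fg_gen b = wsnd U + (- wsnd U + fg_gen b + wsnd U)" by simp
      then show ?thesis by (simp add: add.assoc)
    qed
    then show "wsnd U + fg_gen a\<^sub>1 = fg_gen a\<^sub>1 + wsnd U" "wsnd U + fg_gen a\<^sub>2 = fg_gen a\<^sub>2 + wsnd U"
      using loops by blast+
  qed
  then have "- U + mass 0 + U = mass 0"
    using conj_mass[of "- U" 0] by simp
  then have "mass (ev (ret m g p) v + 0) = mass 0"
    using mass(2) A[of "Sigma_gen m"] m by simp
  then have "ev (ret m g p) v = 0" by simp
  then show ?thesis
    using push fev_e_ret[of "ev fg_gen v"] by simp
qed

text \<open>Send \<tau>_m to 1 and all other generators to 0 in the integers. An inner automorphism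
  keeps the value 1 of \<tau>_m, whereas the decomposition replaces it by that of \<tau>_k.\<close>

lemma inner_imp_pure:
  assumes m: "2 \<le> m" and w: "w \<in> words (gens m)"
    and "\<gamma> \<in> words (gens (m - 1))" "1 \<le> k" "k \<le> m"
    and dec: "ev \<phi> w = ev \<phi> (subst_word (u_subst m g p) v @ \<gamma> @ sigma_down m k)"
    and inner: "ap (ev act w) (ret (m + 1) g p) (Sigma_gen m) =
      - u + ret (m + 1) g p (Sigma_gen m) + u"
  shows "k = m"
proof -
  define f :: "int tuple" where "f b = (if b = Sigma_gen m then 1 else 0)" for b
  have f: "fev f \<circ> ret (m + 1) g p = f"
    using m by (auto simp: fev_ret f_def fun_eq_iff)
  have "ev act w = (ev act (subst_word (u_subst m g p) v @ \<gamma> @ sigma_down m k) :: int tuple symg)"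
    by (rule act_cong) (use assms words_braid_gens_mono in \<open>auto simp: words_u_subst words_sigma_down\<close>)
  then have "ap (ev act w) f (Sigma_gen m) = f (Sigma_gen k)"
    using assms by (simp add: ev_subst_word u_act_abelian act_last_invariant sigma_down_act)
  moreover have "ap (ev act w) f (Sigma_gen m) = fev f (ap (ev act w) (ret (m + 1) g p) (Sigma_gen m))"
    using fun_cong[OF act_word_natural[OF fev_hom, of w f "ret (m + 1) g p"], of "Sigma_gen m"]
    by (simp only: f o_apply)
  moreover have "\<dots> = (fev f \<circ> ret (m + 1) g p) (Sigma_gen m)"
    unfolding inner by simp
  ultimately show ?thesis
    unfolding f by (simp add: f_def split: if_splits)
qed

lemma inner_forget_last:
  assumes m: "2 \<le> m" and w: "w \<in> words (gens m)"
    and \<gamma>: "\<gamma> \<in> words (gens (m - 1))"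
    and dec: "ev \<phi> w = ev \<phi> (subst_word (u_subst m g p) v @ \<gamma>)"
    and inner: "\<And>b. b \<in> gens (m + 1) \<Longrightarrow>
      ap (ev act w) (ret (m + 1) g p) b = - u + ret (m + 1) g p b + u"
  obtains u' where "\<And>b. b \<in> gens m \<Longrightarrow> ap (ev act \<gamma>) (ret m g p) b = - u' + ret m g p b + u'"
proof -
  have f: "fev (ret m g p) \<circ> ret (m + 1) g p = ret m g p"
    by (auto simp: fev_ret ret_def braid_gens_def fun_eq_iff)
  have "Sigma_gen m \<notin> gens m" using m by auto
  \<comment> \<open>The factor \<open>\<gamma>\<close> acts first and keeps the last entry 0, so the
    push that follows acts trivially.\<close>
  then have last: "ap (ev act \<gamma>) (ret m g p) (Sigma_gen m) = 0"
    using act_last_invariant[OF \<gamma> m, of "ret m g p"] m by (simp add: ret_def)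
  have "ev act w = (ev act (subst_word (u_subst m g p) v @ \<gamma>) :: braid_gen fg tuple symg)"
    by (rule act_cong) (use assms words_braid_gens_mono in \<open>auto simp: words_u_subst words_sigma_down\<close>)
  then have "ap (ev act w) (ret m g p) = ap (ev act \<gamma>) (ret m g p)"
    using u_act_trivial[of m "ap (ev act \<gamma>) (ret m g p)", OF _ last] m by (simp add: ev_subst_word)
  then have 1: "ap (ev act \<gamma>) (ret m g p) = fev (ret m g p) \<circ> ap (ev act w) (ret (m + 1) g p)"
    using act_word_natural[OF fev_hom, of w "ret m g p" "ret (m + 1) g p"] f by simp
  show thesis
  proof (rule that[of "fev (ret m g p) u"])
    fix b assume "b \<in> gens m"
    then have "b \<in> gens (m + 1)" by (cases b) auto
    then show "ap (ev act \<gamma>) (ret m g p) b = - fev (ret m g p) u + ret m g p b + fev (ret m g p) u"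
      using fun_cong[OF f, of b] unfolding 1 o_apply inner[OF \<open>b \<in> gens (m + 1)\<close>] by simp
  qed
qed

end

text \<open>Induction on \<open>m\<close> with the conjugator left general. The two loops come from
  the alphabet for one strand and so are available at every stage.\<close>

lemma inner_act_imp_trivial:
  assumes "1 \<le> m" and "w \<in> words (braid_gens m g p)"
    and loops: "is_loop a\<^sub>1" "is_loop a\<^sub>2" "a\<^sub>1 \<noteq> a\<^sub>2" "a\<^sub>1 \<in> braid_gens 1 g p" "a\<^sub>2 \<in> braid_gens 1 g p"
    and "\<And>b. b \<in> braid_gens (m + 1) g p \<Longrightarrow>
      ap (ev act w) (ret (m + 1) g p) b = - u + ret (m + 1) g p b + u"
  shows "pres_eq (braid_gens m g p) (braid_rels m g p) w []"
  using assms(1,2,8)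
proof (induction m arbitrary: w u rule: less_induct)
  case (less m)
  note m = less.prems(1) and w = less.prems(2) and inner = less.prems(3)
  obtain \<phi> :: "braid_gen \<Rightarrow> braid_gen word set symg" where
    \<phi>: "\<And>u v. u \<in> words (braid_gens m g p) \<Longrightarrow> v \<in> words (braid_gens m g p) \<Longrightarrow>
      pres_eq (braid_gens m g p) (braid_rels m g p) u v \<longleftrightarrow> ev \<phi> u = ev \<phi> v"
    using cayley[of "braid_gens m g p" "braid_rels m g p"] by blast
  interpret braid_embedding \<phi> m g p by unfold_locales (rule \<phi>)
  have "\<exists>v. ev \<phi> w = ev e v"
  \<comment> \<open>On one strand there are no \<sigma> letters and \<open>D 1 = 0\<close>, so each
    generator is its own push.\<close>
  proof (cases "m = 1")
    case True
    have "\<phi> b = e b" if "b \<in> gens m" for b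
    proof -
      have "is_loop b" using that True by (cases b) auto
      then show ?thesis using that True e_loop'[of b] D_self by simp
    qed
    then show ?thesis using ev_cong[of "gens m" \<phi> e w] w by blast
  next
    case False
    then have m2: "2 \<le> m" using m by simp
    obtain v \<gamma> k where 1: "\<gamma> \<in> words (gens (m - 1))" "1 \<le> k" "k \<le> m"
      "ev \<phi> w = ev \<phi> (subst_word (u_subst m g p) v @ \<gamma> @ sigma_down m k)"
      using decompose_word[OF w m2] by blast
    have "k = m"
      using inner_imp_pure[OF m2 w 1 inner] m by simp
    with 1 have 2: "ev \<phi> w = ev \<phi> (subst_word (u_subst m g p) v @ \<gamma>)" by simp
    obtain u' where "\<And>b. b \<in> gens m \<Longrightarrow> ap (ev act \<gamma>) (ret m g p) b = - u' + ret m g p b + u'"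
      using inner_forget_last[OF m2 w 1(1) 2 inner] by blast
    \<comment> \<open>The factor on fewer strands is again inner, with a new conjugator
      \<open>u'\<close>, and so is trivial by induction.\<close>
    then have "pres_eq (gens (m - 1)) (braid_rels (m - 1) g p) \<gamma> []"
      using less.IH[of "m - 1" \<gamma> u'] m2 1(1) by simp
    then have "ev \<phi> \<gamma> = ev \<phi> []"
      using \<phi>[of \<gamma> "[]"] pres_eq_braid_mono words_braid_gens_mono[OF 1(1)] by auto
    then show ?thesis using 2 by (auto simp: ev_e)
  qed
  then obtain v where v: "ev \<phi> w = ev e v" ..
  have "a\<^sub>1 \<in> gens m" "a\<^sub>2 \<in> gens m" using loops loop_gens by blast+
  then have "ev \<phi> w = 0" using inner_push_trivial[OF m w v loops(3) _ _ inner] by blast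
  then show ?case using \<phi>[OF w, of "[]"] by simp
qed

section \<open>The outer representation\<close>

lemma (in group) conj_on_subgroup_generated_auto:
  fixes S
  defines "H \<equiv> carrier (subgroup_generated G S)"
  assumes b: "b \<in> carrier G"
    and closed: "\<And>h. h \<in> H \<Longrightarrow> inv b \<otimes> h \<otimes> b \<in> H" "\<And>h. h \<in> H \<Longrightarrow> b \<otimes> h \<otimes> inv b \<in> H"
  shows "conj_on G H b \<in> auto (subgroup_generated G S)"
proof -
  have H: "h \<in> carrier G" if "h \<in> H" for h
    using that carrier_subgroup_generated_subset unfolding H_def by blast
  have mult: "h \<otimes> k \<in> H" if "h \<in> H" "k \<in> H" for h k
    using that unfolding H_def carrier_subgroup_generated by (rule generate.eng)
  have closed': "inv b \<otimes> (h \<otimes> b) \<in> H" if "h \<in> H" for h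
    using closed(1)[OF that] H[OF that] b by (simp add: m_assoc)
  have "bij_betw (conj_on G H b) H H"
    by (rule bij_betwI[where g = "\<lambda>u. b \<otimes> u \<otimes> inv b"])
      (use b H closed in \<open>auto simp: conj_on_def m_assoc inv_mult_cancel mult_inv_cancel\<close>)
  moreover have "conj_on G H b \<in> hom (subgroup_generated G S) (subgroup_generated G S)"
    unfolding hom_def H_def[symmetric]
    by (auto simp: conj_on_def closed' mult b H m_assoc mult_inv_cancel)
  ultimately show ?thesis
    by (simp add: auto_def Bij_def conj_on_def H_def)
qed

lemma subst_word_append [simp]: "subst_word h (u @ v) = subst_word h u @ subst_word h v"
  by (induction h u rule: subst_word.induct) auto

lemma braid_class_eq_iff:
  "u \<in> words (braid_gens n g p) \<Longrightarrow> braid_class n g p u = braid_class n g p v \<longleftrightarrow>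
    pres_eq (braid_gens n g p) (braid_rels n g p) u v"
  by (simp add: braid_class_def word_class_eq_iff)

lemma inv_braid_class:
  "w \<in> words (braid_gens n g p) \<Longrightarrow> inv\<^bsub>surface_braid_group n g p\<^esub> (braid_class n g p w) = braid_class n g p (winv w)"
  by (simp add: braid_class_def surface_braid_group_def inv_word_class)

lemma one_surface_braid_group: "\<one>\<^bsub>surface_braid_group n g p\<^esub> = braid_class n g p []"
  by (simp add: braid_class_def surface_braid_group_def one_presented_group)

lemma U_gens_eq: "U_gens n g p = (\<lambda>b. braid_class n g p (u_word n b)) ` braid_gens n g p"
  by (simp add: U_gens_def braid_gens_def image_Un image_image)

lemma U_gens_subset: "U_gens n g p \<subseteq> carrier (surface_braid_group n g p)"
  by (auto simp: U_gens_eq carrier_surface_braid_group words_u_word)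

text \<open>Letters outside the alphabet are substituted by the empty word, so arbitrary words may
  serve as parameters.\<close>

lemma carrier_U_group:
  "carrier (U_group n g p) = range (\<lambda>v. braid_class n g p (subst_word (u_subst n g p) v))"
    (is "_ = range ?c")
proof
  let ?G = "surface_braid_group n g p"
  have U: "carrier (U_group n g p) = generate ?G (U_gens n g p)"
    using U_gens_subset by (simp add: U_group_def carrier_subgroup_generated Int_absorb1)
  have mult: "?c u \<otimes>\<^bsub>?G\<^esub> ?c v = ?c (u @ v)" for u v
    by (simp add: braid_class_mult words_u_subst)
  have gen: "?c [(b, True)] = braid_class n g p (u_word n b)"
    "?c [(b, False)] = inv\<^bsub>?G\<^esub> (braid_class n g p (u_word n b))" if "b \<in> braid_gens n g p" for b
    using that by (simp_all add: u_subst_def inv_braid_class words_u_word)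
  show "carrier (U_group n g p) \<subseteq> range ?c"
  proof
    fix h assume "h \<in> carrier (U_group n g p)"
    then show "h \<in> range ?c"
      unfolding U
    proof (induction rule: generate.induct)
      case one
      then show ?case by (intro range_eqI[of _ _ "[]"]) (simp add: one_surface_braid_group)
    next
      case (incl h)
      then show ?case using gen(1) by (auto simp: U_gens_eq simp del: subst_word.simps)
    next
      case (inv h)
      then show ?case using gen(2) by (auto simp: U_gens_eq simp del: subst_word.simps)
    next
      case (eng h k)
      then obtain u v where "h = ?c u" "k = ?c v" by blast
      then show ?case by (simp only: mult) (rule rangeI)
    qed
  qed
  show "range ?c \<subseteq> carrier (U_group n g p)"
  proof
    fix h assume "h \<in> range ?c"
    then obtain v where "h = ?c v" by blast
    moreover have "?c v \<in> generate ?G (U_gens n g p)"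
    proof (induction v)
      case Nil
      then show ?case using generate.one[of ?G] by (simp add: one_surface_braid_group)
    next
      case (Cons l v)
      obtain b t where l: "l = (b, t)" by fastforce
      have "?c [l] \<in> generate ?G (U_gens n g p)"
      proof (cases "b \<in> braid_gens n g p")
        case True
        then have "braid_class n g p (u_word n b) \<in> U_gens n g p" by (simp add: U_gens_eq)
        then show ?thesis
          using gen[OF True] by (cases t) (simp_all add: l generate.incl generate.inv del: subst_word.simps)
      next
        case False
        then show ?thesis
          using generate.one[of ?G] by (simp add: l u_subst_def one_surface_braid_group)
      qed
      then show ?case
        using generate.eng[OF _ Cons] mult[of "[l]" v] by fastforce
    qed
    ultimately show "h \<in> carrier (U_group n g p)" by (simp add: U)
  qed
qed

lemma rho_U_braid_class:
  assumes "w \<in> words (braid_gens (n - 1) g p)"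
  shows "rho_U n g p (braid_class (n - 1) g p w) =
    conj_on (surface_braid_group n g p) (carrier (U_group n g p)) (braid_class n g p w)"
  by (simp only: rho_U_def add_strand_braid_class[OF assms])

lemma conj_braid_class:
  assumes "w \<in> words (braid_gens n g p)" "u \<in> words (braid_gens n g p)"
  shows "inv\<^bsub>surface_braid_group n g p\<^esub> (braid_class n g p w) \<otimes>\<^bsub>surface_braid_group n g p\<^esub>
      braid_class n g p u \<otimes>\<^bsub>surface_braid_group n g p\<^esub> braid_class n g p w =
    braid_class n g p (winv w @ u @ w)"
  using assms by (simp add: inv_braid_class braid_class_mult)

lemma conj_U_group:
  assumes "2 \<le> n" and w: "w \<in> words (braid_gens (n - 1) g p)" and u: "u \<in> carrier (U_group n g p)"
  shows "inv\<^bsub>surface_braid_group n g p\<^esub> (braid_class n g p w) \<otimes>\<^bsub>surface_braid_group n g p\<^esub>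
    u \<otimes>\<^bsub>surface_braid_group n g p\<^esub> braid_class n g p w \<in> carrier (U_group n g p)"
proof -
  obtain \<phi> :: "braid_gen \<Rightarrow> braid_gen word set symg" where
    \<phi>: "\<And>u v. u \<in> words (braid_gens n g p) \<Longrightarrow> v \<in> words (braid_gens n g p) \<Longrightarrow>
      pres_eq (braid_gens n g p) (braid_rels n g p) u v \<longleftrightarrow> ev \<phi> u = ev \<phi> v"
    using cayley[of "braid_gens n g p" "braid_rels n g p"] by blast
  interpret braid_embedding \<phi> n g p by unfold_locales (rule \<phi>)
  have wn: "w \<in> words (gens n)" using w by (rule words_braid_gens_mono)
  obtain v where v: "u = braid_class n g p (subst_word (u_subst n g p) v)"
    using u by (auto simp: carrier_U_group)
  obtain v' where v': "ev fg_gen v' = fev (ap (ev act w) fg_gen) (ev fg_gen v)"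
    using ev_fg_gen_surj by metis
  have "- ev \<phi> w + fev e (ev fg_gen v) + ev \<phi> w = fev e (ev fg_gen v')"
    unfolding v' by (rule conj_fev_e) (use w assms(1) in auto)
  then have "ev \<phi> (winv w @ subst_word (u_subst n g p) v @ w) = ev \<phi> (subst_word (u_subst n g p) v')"
    by (simp add: ev_e add.assoc)
  then have "braid_class n g p (winv w @ subst_word (u_subst n g p) v @ w) =
      braid_class n g p (subst_word (u_subst n g p) v')"
    using wn by (simp add: braid_class_eq_iff \<phi> words_u_subst)
  then show ?thesis
    by (simp add: v conj_braid_class wn words_u_subst carrier_U_group)
qed

lemma rho_U_auto:
  assumes "2 \<le> n" and "\<beta> \<in> carrier (surface_braid_group (n - 1) g p)"
  shows "rho_U n g p \<beta> \<in> auto (U_group n g p)"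
proof -
  interpret G: group "surface_braid_group n g p" by (rule group_surface_braid_group)
  obtain w where w: "w \<in> words (braid_gens (n - 1) g p)" "\<beta> = braid_class (n - 1) g p w"
    using assms(2) by (auto simp: carrier_surface_braid_group)
  have wn: "w \<in> words (braid_gens n g p)" using w(1) by (rule words_braid_gens_mono)
  show ?thesis
    unfolding w(2) rho_U_braid_class[OF w(1)]
    unfolding U_group_def
    by (rule G.conj_on_subgroup_generated_auto)
      (use conj_U_group[OF assms(1) w(1)] conj_U_group[OF assms(1), of "winv w" g p] w(1) wn in
        \<open>auto simp: U_group_def carrier_surface_braid_group inv_braid_class G.inv_inv simp flip: inv_braid_class\<close>)
qed

lemma rho_U_hom:
  assumes "2 \<le> n"
  shows "rho_U n g p \<in> hom (surface_braid_group (n - 1) g p) (right_Aut (U_group n g p))"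
proof (rule homI)
  let ?G = "surface_braid_group n g p"
  interpret G: group ?G by (rule group_surface_braid_group)
  interpret G': group "surface_braid_group (n - 1) g p" by (rule group_surface_braid_group)
  fix \<beta> \<gamma>
  assume \<beta>: "\<beta> \<in> carrier (surface_braid_group (n - 1) g p)"
  then show "rho_U n g p \<beta> \<in> carrier (right_Aut (U_group n g p))"
    using rho_U_auto[OF assms] by (simp add: carrier_right_Aut)
  assume \<gamma>: "\<gamma> \<in> carrier (surface_braid_group (n - 1) g p)"
  define b c where "b = add_strand n g p \<beta>" and "c = add_strand n g p \<gamma>"
  have bc: "b \<in> carrier ?G" "c \<in> carrier ?G"
    "add_strand n g p (\<beta> \<otimes>\<^bsub>surface_braid_group (n - 1) g p\<^esub> \<gamma>) = b \<otimes>\<^bsub>?G\<^esub> c"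
    using add_strand_hom[of n g p] \<beta> \<gamma> by (auto simp: hom_def b_def c_def)
  have U: "u \<in> carrier ?G" if "u \<in> carrier (U_group n g p)" for u
    using that G.carrier_subgroup_generated_subset by (auto simp: U_group_def)
  have "rho_U n g p \<beta> u \<in> carrier (U_group n g p)" if "u \<in> carrier (U_group n g p)" for u
    using rho_U_auto[OF assms \<beta>] that by (auto simp: auto_def hom_def)
  then have closed: "inv\<^bsub>?G\<^esub> b \<otimes>\<^bsub>?G\<^esub> u \<otimes>\<^bsub>?G\<^esub> b \<in> carrier (U_group n g p)"
    if "u \<in> carrier (U_group n g p)" for u
    using that by (simp add: rho_U_def conj_on_def b_def)
  show "rho_U n g p (\<beta> \<otimes>\<^bsub>surface_braid_group (n - 1) g p\<^esub> \<gamma>) =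
      rho_U n g p \<beta> \<otimes>\<^bsub>right_Aut (U_group n g p)\<^esub> rho_U n g p \<gamma>"
    unfolding mult_right_Aut[OF rho_U_auto[OF assms \<beta>] rho_U_auto[OF assms \<gamma>]]
    unfolding rho_U_def bc(3) b_def[symmetric] c_def[symmetric]
    using bc U closed
    by (auto simp: compose_def conj_on_def G.m_assoc G.inv_mult_group intro!: restrict_ext)
qed

text \<open>Freeness lifts the equality of two conjugations on U to one of tuples over the free
  group, where \<open>inner_act_imp_trivial\<close> applies with \<open>m = n - 1\<close>.\<close>

lemma inner_rho_U_imp_one:
  assumes n: "3 \<le> n" and gp: "(g > 0 \<and> p > 0) \<or> (g = 0 \<and> p > 2)"
    and \<beta>: "\<beta> \<in> carrier (surface_braid_group (n - 1) g p)"
    and inner: "rho_U n g p \<beta> \<in> Inn (U_group n g p)"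
  shows "\<beta> = \<one>\<^bsub>surface_braid_group (n - 1) g p\<^esub>"
proof -
  let ?G = "surface_braid_group n g p" and ?H = "U_group n g p"
  interpret G: group ?G by (rule group_surface_braid_group)
  obtain \<phi> :: "braid_gen \<Rightarrow> braid_gen word set symg" where
    \<phi>: "\<And>u v. u \<in> words (braid_gens n g p) \<Longrightarrow> v \<in> words (braid_gens n g p) \<Longrightarrow>
      pres_eq (braid_gens n g p) (braid_rels n g p) u v \<longleftrightarrow> ev \<phi> u = ev \<phi> v"
    using cayley[of "braid_gens n g p" "braid_rels n g p"] by blast
  interpret braid_embedding \<phi> n g p by unfold_locales (rule \<phi>)
  obtain w where w: "w \<in> words (gens (n - 1))" "\<beta> = braid_class (n - 1) g p w"
    using \<beta> by (auto simp: carrier_surface_braid_group)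
  have wn: "w \<in> words (gens n)" using w(1) by (rule words_braid_gens_mono)
  obtain a where a: "a \<in> carrier ?H" "rho_U n g p \<beta> = conj_on ?H (carrier ?H) a"
    using inner by (auto simp: Inn_def)
  let ?uw = "subst_word (u_subst n g p)"
  obtain z where z: "a = braid_class n g p (?uw z)"
    using a(1) by (auto simp: carrier_U_group)
  have H: "mult ?H = mult ?G" "inv\<^bsub>?H\<^esub> a = inv\<^bsub>?G\<^esub> a"
    using a(1) by (auto simp: U_group_def)
  define x where "x = ev fg_gen z"
  have conj: "fev e (ap (ev act w) fg_gen b) = fev e (- x + fg_gen b + x)" for b
  proof -
    let ?c = "braid_class n g p (?uw [(b, True)])"
    have "?c \<in> carrier ?H" by (auto simp: carrier_U_group simp del: subst_word.simps)
    moreover have "conj_on ?G (carrier ?H) (braid_class n g p w) ?c = conj_on ?H (carrier ?H) a ?c"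
      using fun_cong[OF a(2), of ?c] unfolding w(2) rho_U_braid_class[OF w(1)] .
    ultimately have "inv\<^bsub>?G\<^esub> (braid_class n g p w) \<otimes>\<^bsub>?G\<^esub> ?c \<otimes>\<^bsub>?G\<^esub> braid_class n g p w =
        inv\<^bsub>?G\<^esub> a \<otimes>\<^bsub>?G\<^esub> ?c \<otimes>\<^bsub>?G\<^esub> a"
      by (simp add: conj_on_def H)
    then have "braid_class n g p (winv w @ ?uw [(b, True)] @ w) =
        braid_class n g p (winv (?uw z) @ ?uw [(b, True)] @ ?uw z)"
      by (simp only: z conj_braid_class[OF wn words_u_subst] conj_braid_class[OF words_u_subst words_u_subst])
    then have "ev \<phi> (winv w @ ?uw [(b, True)] @ w) = ev \<phi> (winv (?uw z) @ ?uw [(b, True)] @ ?uw z)"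
      using wn by (subst (asm) braid_class_eq_iff, simp_all add: words_u_subst \<phi> del: subst_word.simps)
    then have *: "- ev \<phi> w + e b + ev \<phi> w = fev e (- x + fg_gen b + x)"
      by (simp add: ev_e x_def add.assoc del: subst_word.simps)
    have "fev e (ap (ev act w) fg_gen b) = fev e (fev (ap (ev act w) fg_gen) (fg_gen b))"
      by simp
    also have "\<dots> = - ev \<phi> w + e b + ev \<phi> w"
      using conj_fev_e[OF w(1), of "fg_gen b"] n by simp
    finally show ?thesis by (simp only: *)
  qed
  \<comment> \<open>Here the assumption on \<open>g\<close> and \<open>p\<close> enters: it provides
    two loop letters.\<close>
  obtain a\<^sub>1 a\<^sub>2 where loops: "is_loop a\<^sub>1" "is_loop a\<^sub>2" "a\<^sub>1 \<noteq> a\<^sub>2" "a\<^sub>1 \<in> gens 1" "a\<^sub>2 \<in> gens 1"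
  proof (cases "g > 0")
    case True
    show thesis by (rule that[of "X_gen 1" "X_gen 2"]) (use True in auto)
  next
    case False
    show thesis by (rule that[of "Z_gen 1" "Z_gen 2"]) (use False gp in auto)
  qed
  have "pres_eq (gens (n - 1)) (braid_rels (n - 1) g p) w []"
  proof (rule inner_act_imp_trivial[OF _ w(1) loops])
    show "1 \<le> n - 1" using n by simp
    have n1: "n - 1 + 1 = n" using n by simp
    fix b
    let ?y = "ap (ev act w) fg_gen b" and ?r = "fev (ret n g p)"
    \<comment> \<open>The identity holds in U only after \<open>fev e\<close>; freeness turns it
      into one in the free group.\<close>
    have "fev e (?y - (- x + fg_gen b + x)) = 0" using conj[of b] by simp
    then have "?r (?y - (- x + fg_gen b + x)) = 0" by (rule fev_e_eq_0_imp) (use n in simp)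
    then have "?r ?y = - ?r x + ret n g p b + ?r x" by simp
    moreover have "?r ?y = ap (ev act w) (ret n g p) b"
    proof -
      have "?r \<circ> fg_gen = ret n g p" by (simp add: fun_eq_iff)
      then show ?thesis
        using fun_cong[OF act_word_natural[OF fev_hom, of w "ret n g p" fg_gen], of b] by simp
    qed
    ultimately show "ap (ev act w) (ret (n - 1 + 1) g p) b = - ?r x + ret (n - 1 + 1) g p b + ?r x"
      unfolding n1 by simp
  qed
  then show ?thesis
    using w by (simp add: one_surface_braid_group braid_class_eq_iff)
qed

theorem theorem3:
  fixes n g p :: nat
  assumes "n \<ge> 3"
    and "(g > 0 \<and> p > 0) \<or> (g = 0 \<and> p > 2)"
  shows "Out_proj (U_group n g p) \<circ> rho_U n g p
           \<in> mon (surface_braid_group (n - 1) g p) (Out (U_group n g p))"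
proof -
  let ?H = "U_group n g p"
  interpret H: group ?H by (rule group_U_group)
  interpret A: group "right_Aut ?H" by (rule H.group_right_Aut)
  have hom: "rho_U n g p \<in> hom (surface_braid_group (n - 1) g p) (right_Aut ?H)"
    using assms(1) by (intro rho_U_hom) simp
  have "\<beta> = \<one>\<^bsub>surface_braid_group (n - 1) g p\<^esub>"
    if \<beta>: "\<beta> \<in> carrier (surface_braid_group (n - 1) g p)"
      and "(Out_proj ?H \<circ> rho_U n g p) \<beta> = \<one>\<^bsub>Out ?H\<^esub>" for \<beta>
  proof -
    \<comment> \<open>Being trivial in the quotient means that the coset is \<open>Inn ?H\<close>
      itself, hence that the automorphism is inner.\<close>
    have "Inn ?H #>\<^bsub>right_Aut ?H\<^esub> rho_U n g p \<beta> = Inn ?H"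
      using that(2) by (simp add: Out_proj_def Out_def FactGroup_def)
    moreover have "rho_U n g p \<beta> \<in> carrier (right_Aut ?H)"
      using hom \<beta> by (auto simp: hom_def)
    ultimately have "rho_U n g p \<beta> \<in> Inn ?H"
      using A.coset_join1 H.Inn_normal normal_imp_subgroup subgroup.subset by metis
    then show ?thesis by (rule inner_rho_U_imp_one[OF assms \<beta>])
  qed
  then show ?thesis
    using hom_compose[OF hom H.Out_proj_hom] group_surface_braid_group H.group_Out
    by (auto simp: mon_iff_hom_one)
qed

end
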